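(* Let $\preceq$ be a left-invariant total order on a countable group $\Gamma$, let $(g_n)_{n\ge0}$ be a numbering of the elements of $\Gamma$ with $g_0 = id$, and consider the corresponding dynamical realization of $\preceq$. Define $$\alpha = \sup\{b<0 : \text{ there exist } f,g \in \Gamma \text{ and } a<b \text{ such that } f,g \text{ are crossed on } ]a,b[\},$$ $$\beta = \inf\{a>0 : \text{ there exist } f,g \in \Gamma \text{ and } b>a \text{ such that } f,g \text{ are crossed on } ]a,b[\},$$ where $\alpha=-\infty$ (resp. $\beta=+\infty$) if the corresponding set is empty. Then the $\preceq$-Conradian soul of $\Gamma$ coincides with the stabilizer of the interval $]\alpha,\beta[$ in $\Gamma$ (for the dynamical realization).
   Context: A left-invariant total order $\preceq$ is Conradian (a $\mathcal{C}$-order) if for all $f \succ id$, $g\succ id$ there exists $n\in\mathbb{N}$ with $fg^n\succ g$. A subgroup $\Gamma_*\subset\Gamma$ is $\preceq$-convex if $f\prec h\prec g$ with $f,g\in\Gamma_*$, $h \in \Gamma$, implies $h\in\Gamma_*$; it is $\preceq$-Conradian if the restriction of $\preceq$ to $\Gamma_*$ is Conradian. The $\preceq$-Conradian soul of $\Gamma$ is the maximal subgroup of $\Gamma$ that is simultaneously $\preceq$-convex and $\preceq$-Conradian (it exists since convex subgroups are linearly ordered by inclusion). Dynamical realization: for a numbering $(g_i)_{i\ge0}$ of $\Gamma$ (without repetition), define $t:\Gamma\to\mathbb{R}$ inductively: $t(g_0)=0$; given $t(g_0),\ldots,t(g_i)$, if $g_{i+1}$ is bigger (resp. smaller) than all of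 $g_0,\ldots,g_i$, put $t(g_{i+1}) = \max\{t(g_0),\ldots,t(g_i)\}+1$ (resp. $\min\{t(g_0),\ldots,t(g_i)\}-1$); if $g_m \prec g_{i+1}\prec g_n$ with $m,n\le i$ and no $g_j$, $0\le j\le i$, lies strictly between $g_m$ and $g_n$, put $t(g_{i+1}) = (t(g_m)+t(g_n))/2$. The group $\Gamma$ acts on $t(\Gamma)$ by $g(t(g_i)) = t(gg_i)$; this action extends continuously to the closure of $t(\Gamma)$ and then to $\mathbb{R}$ by extending affinely on each complementary interval of the closure (the trivial group acts trivially). The resulting action by orientation-preserving homeomorphisms of $\mathbb{R}$ is the dynamical realization. Two orientation-preserving homeomorphisms of $\mathbb{R}$ are crossed on an interval $]a,b[$ if one of them fixes $a$ and $b$ and no other point in $[a,b]$, while the other one sends $a$ or $b$ into $]a,b[$; the cases $a=-\infty$ or $b=+\infty$ are allowed ($\pm\infty$ being regarded as fixed by every homeomorphism). The stabilizer of $]\alpha,\beta[$ is the set of $g\in\Gamma$ with $g(\alpha)=\alpha$ and $g(\beta)=\beta$ (with the convention $g(\pm\infty)=\pm\infty$); this reading is also used in the degenerate case $\alpha=\beta=0$. *)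

theory Defs
  imports "HOL-Analysis.Analysis" "HOL-Algebra.Group"
begin

definition strictly_below :: "('a \<times> 'a) set \<Rightarrow> 'a \<Rightarrow> 'a \<Rightarrow> bool" where
  "strictly_below r x y \<longleftrightarrow> (x, y) \<in> r \<and> x \<noteq> y"

definition left_invariant_order :: "('a, 'm) monoid_scheme \<Rightarrow> ('a \<times> 'a) set \<Rightarrow> bool" where
  "left_invariant_order G r \<longleftrightarrow>
     linear_order_on (carrier G) r \<and>
     (\<forall>f\<in>carrier G. \<forall>g\<in>carrier G. \<forall>h\<in>carrier G.
        (g, h) \<in> r \<longrightarrow> (f \<otimes>\<^bsub>G\<^esub> g, f \<otimes>\<^bsub>G\<^esub> h) \<in> r)"

definition conradian_on :: "('a, 'm) monoid_scheme \<Rightarrow> ('a \<times> 'a) set \<Rightarrow> 'a set \<Rightarrow> bool" where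
  "conradian_on G r H \<longleftrightarrow>
     (\<forall>f\<in>H. \<forall>g\<in>H. strictly_below r \<one>\<^bsub>G\<^esub> f \<longrightarrow> strictly_below r \<one>\<^bsub>G\<^esub> g \<longrightarrow>
        (\<exists>n::nat. strictly_below r g (f \<otimes>\<^bsub>G\<^esub> (g [^]\<^bsub>G\<^esub> n))))"

definition order_convex :: "('a, 'm) monoid_scheme \<Rightarrow> ('a \<times> 'a) set \<Rightarrow> 'a set \<Rightarrow> bool" where
  "order_convex G r H \<longleftrightarrow>
     (\<forall>f\<in>H. \<forall>g\<in>H. \<forall>h\<in>carrier G.
        strictly_below r f h \<longrightarrow> strictly_below r h g \<longrightarrow> h \<in> H)"

definition conradian_soul :: "('a, 'm) monoid_scheme \<Rightarrow> ('a \<times> 'a) set \<Rightarrow> 'a set" where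
  "conradian_soul G r =
     (GREATEST H. subgroup H G \<and> order_convex G r H \<and> conradian_on G r H)"

text \<open>A left-orderable group is either trivial or infinite. To cover the trivial group as well, a
  numbering runs over all of \<open>\<nat>\<close> if the group is infinite, and over an initial segment otherwise.\<close>

definition numbering_indices :: "('a, 'm) monoid_scheme \<Rightarrow> nat set" where
  "numbering_indices G = (if finite (carrier G) then {..<card (carrier G)} else UNIV)"

definition numbering :: "('a, 'm) monoid_scheme \<Rightarrow> (nat \<Rightarrow> 'a) \<Rightarrow> bool" where
  "numbering G gs \<longleftrightarrow> bij_betw gs (numbering_indices G) (carrier G)"

text \<open>\<open>index_pos r gs i\<close> is the real number \<open>t(g\<^sub>i)\<close>.\<close>

fun index_pos :: "('a \<times> 'a) set \<Rightarrow> (nat \<Rightarrow> 'a) \<Rightarrow> nat \<Rightarrow> real" where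
  "index_pos r gs 0 = 0"
| "index_pos r gs (Suc i) =
     (if \<forall>j\<in>{..i}. strictly_below r (gs j) (gs (Suc i))
      then Max ((\<lambda>j. index_pos r gs j) ` {..i}) + 1
      else if \<forall>j\<in>{..i}. strictly_below r (gs (Suc i)) (gs j)
      then Min ((\<lambda>j. index_pos r gs j) ` {..i}) - 1
      else (THE x. \<exists>m\<in>{..i}. \<exists>n\<in>{..i}.
              strictly_below r (gs m) (gs (Suc i)) \<and> strictly_below r (gs (Suc i)) (gs n) \<and>
              (\<forall>j\<in>{..i}. \<not> (strictly_below r (gs m) (gs j) \<and> strictly_below r (gs j) (gs n))) \<and>
              x = (index_pos r gs m + index_pos r gs n) / 2))"

definition pos :: "('a, 'm) monoid_scheme \<Rightarrow> ('a \<times> 'a) set \<Rightarrow> (nat \<Rightarrow> 'a) \<Rightarrow> 'a \<Rightarrow> real" where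
  "pos G r gs h = index_pos r gs (inv_into (numbering_indices G) gs h)"

definition orbit :: "('a, 'm) monoid_scheme \<Rightarrow> ('a \<times> 'a) set \<Rightarrow> (nat \<Rightarrow> 'a) \<Rightarrow> real set" where
  "orbit G r gs = pos G r gs ` carrier G"

definition orbit_action ::
  "('a, 'm) monoid_scheme \<Rightarrow> ('a \<times> 'a) set \<Rightarrow> (nat \<Rightarrow> 'a) \<Rightarrow> 'a \<Rightarrow> real \<Rightarrow> real" where
  "orbit_action G r gs g x = pos G r gs (g \<otimes>\<^bsub>G\<^esub> inv_into (carrier G) (pos G r gs) x)"

text \<open>The continuous extension to the closure of the orbit. Points of the orbit are treated
  separately since they may be isolated, in which case \<open>at x within orbit G r gs\<close> is trivial.\<close>

definition closure_action ::
  "('a, 'm) monoid_scheme \<Rightarrow> ('a \<times> 'a) set \<Rightarrow> (nat \<Rightarrow> 'a) \<Rightarrow> 'a \<Rightarrow> real \<Rightarrow> real" where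
  "closure_action G r gs g x =
     (if x \<in> orbit G r gs then orbit_action G r gs g x
      else Lim (at x within orbit G r gs) (orbit_action G r gs g))"

text \<open>For a nontrivial group the orbit is unbounded in both directions, so that every complementary
  interval \<open>]a, b[\<close> of its closure is bounded.\<close>

definition dynamical_realization ::
  "('a, 'm) monoid_scheme \<Rightarrow> ('a \<times> 'a) set \<Rightarrow> (nat \<Rightarrow> 'a) \<Rightarrow> 'a \<Rightarrow> real \<Rightarrow> real" where
  "dynamical_realization G r gs g x =
     (if carrier G = {\<one>\<^bsub>G\<^esub>} then x
      else if x \<in> closure (orbit G r gs) then closure_action G r gs g x
      else let a = Sup {s \<in> closure (orbit G r gs). s < x};
               b = Inf {s \<in> closure (orbit G r gs). x < s}
           in closure_action G r gs g a +
              (x - a) / (b - a) * (closure_action G r gs g b - closure_action G r gs g a))"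

definition extend_ereal :: "(real \<Rightarrow> real) \<Rightarrow> ereal \<Rightarrow> ereal" where
  "extend_ereal f x = (case x of ereal u \<Rightarrow> ereal (f u) | PInfty \<Rightarrow> \<infinity> | MInfty \<Rightarrow> - \<infinity>)"

definition fixes_only_ends :: "(real \<Rightarrow> real) \<Rightarrow> ereal \<Rightarrow> ereal \<Rightarrow> bool" where
  "fixes_only_ends f a b \<longleftrightarrow> {x \<in> {a..b}. extend_ereal f x = x} = {a, b}"

definition sends_end_inside :: "(real \<Rightarrow> real) \<Rightarrow> ereal \<Rightarrow> ereal \<Rightarrow> bool" where
  "sends_end_inside g a b \<longleftrightarrow> extend_ereal g a \<in> {a<..<b} \<or> extend_ereal g b \<in> {a<..<b}"

definition crossed_on :: "(real \<Rightarrow> real) \<Rightarrow> (real \<Rightarrow> real) \<Rightarrow> ereal \<Rightarrow> ereal \<Rightarrow> bool" where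
  "crossed_on f g a b \<longleftrightarrow> a < b \<and>
     ((fixes_only_ends f a b \<and> sends_end_inside g a b) \<or>
      (fixes_only_ends g a b \<and> sends_end_inside f a b))"

text \<open>In \<open>ereal\<close>, \<open>Sup {} = -\<infinity>\<close> and \<open>Inf {} = \<infinity>\<close>, as required when there is no crossing.\<close>

definition crossing_alpha ::
  "('a, 'm) monoid_scheme \<Rightarrow> ('a \<times> 'a) set \<Rightarrow> (nat \<Rightarrow> 'a) \<Rightarrow> ereal" where
  "crossing_alpha G r gs =
     Sup {b. b < 0 \<and> (\<exists>f\<in>carrier G. \<exists>g\<in>carrier G. \<exists>a<b.
       crossed_on (dynamical_realization G r gs f) (dynamical_realization G r gs g) a b)}"

definition crossing_beta ::
  "('a, 'm) monoid_scheme \<Rightarrow> ('a \<times> 'a) set \<Rightarrow> (nat \<Rightarrow> 'a) \<Rightarrow> ereal" where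
  "crossing_beta G r gs =
     Inf {a. a > 0 \<and> (\<exists>f\<in>carrier G. \<exists>g\<in>carrier G. \<exists>b>a.
       crossed_on (dynamical_realization G r gs f) (dynamical_realization G r gs g) a b)}"

definition interval_stabilizer ::
  "('a, 'm) monoid_scheme \<Rightarrow> ('a \<times> 'a) set \<Rightarrow> (nat \<Rightarrow> 'a) \<Rightarrow> ereal \<Rightarrow> ereal \<Rightarrow> 'a set" where
  "interval_stabilizer G r gs a b =
     {g \<in> carrier G. extend_ereal (dynamical_realization G r gs g) a = a \<and>
                     extend_ereal (dynamical_realization G r gs g) b = b}"

end

theory Submission
  imports Defs
begin

text \<open>
  Conradian orders and crossings exclude each other. If \<open>f\<close> moves the points of \<open>]a, b[\<close> to the
  right, fixing \<open>a\<close> and \<open>b\<close>, and \<open>g\<close> sends \<open>b\<close> inside, then a suitable \<open>F = f\<^sup>j g f\<^sup>m\<close> moves a given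
  orbit point \<open>x\<close> to the right with \<open>F b < b\<close>, while \<open>u = f\<^sup>i\<close> satisfies \<open>F b < u x\<close>; hence
  \<open>F u\<^sup>n x < u x\<close> for all \<open>n\<close>, and conjugating \<open>x\<close> to \<open>0\<close> violates the Conradian property.
  Conversely, if \<open>f g\<^sup>n \<preceq> g\<close> for all \<open>n\<close>, then \<open>f\<close> and \<open>g\<close> are crossed on the interval between the last
  fixed point of \<open>g\<close> before \<open>0\<close> and the limit of \<open>g\<^sup>n 0\<close>.

  Every crossing \<open>]a, b[\<close> moreover produces crossings whose left ends accumulate at \<open>b\<close> and crossings
  whose right ends accumulate at \<open>a\<close>. So no crossing has an end in \<open>]\<alpha>, \<beta>[\<close>, which makes the stabilizer
  of this interval convex and Conradian. A convex Conradian subgroup \<open>H\<close> permits no crossing with an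
  end inside the convex hull of its orbit; the set of crossing ends below (above) \<open>0\<close> is therefore
  \<open>H\<close>-invariant and \<open>H\<close> fixes \<open>\<alpha>\<close> and \<open>\<beta>\<close>.
\<close>

section \<open>Crossings of actions on the extended line\<close>

text \<open>Order-preserving bijections of \<open>ereal\<close> are automatically homeomorphisms
  fixing both infinite points, so monotonicity and the group law carry all topological
  information.\<close>

locale line_action = group G for G :: "('a, 'm) monoid_scheme" (structure) +
  fixes \<phi> :: "'a \<Rightarrow> ereal \<Rightarrow> ereal"
  assumes act_one: "\<phi> \<one> x = x"
    and act_mult: "g \<in> carrier G \<Longrightarrow> h \<in> carrier G \<Longrightarrow> \<phi> (g \<otimes> h) x = \<phi> g (\<phi> h x)"
    and act_strict: "g \<in> carrier G \<Longrightarrow> x < y \<Longrightarrow> \<phi> g x < \<phi> g y"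
begin

lemma act_less_iff: "g \<in> carrier G \<Longrightarrow> \<phi> g x < \<phi> g y \<longleftrightarrow> x < y"
  by (metis act_strict not_less_iff_gr_or_eq)

lemma act_le_iff: "g \<in> carrier G \<Longrightarrow> \<phi> g x \<le> \<phi> g y \<longleftrightarrow> x \<le> y"
  by (metis act_less_iff not_less)

lemma act_inv_act [simp]: "g \<in> carrier G \<Longrightarrow> \<phi> (inv g) (\<phi> g x) = x"
  by (metis act_mult act_one inv_closed l_inv)

lemma act_act_inv [simp]: "g \<in> carrier G \<Longrightarrow> \<phi> g (\<phi> (inv g) x) = x"
  by (metis act_mult act_one inv_closed r_inv)

lemma act_inv_less_iff: "g \<in> carrier G \<Longrightarrow> \<phi> (inv g) x < y \<longleftrightarrow> x < \<phi> g y"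
  by (metis act_act_inv act_less_iff)

lemma less_act_inv_iff: "g \<in> carrier G \<Longrightarrow> x < \<phi> (inv g) y \<longleftrightarrow> \<phi> g x < y"
  by (metis act_act_inv act_less_iff)

lemma act_inv_eq_iff: "g \<in> carrier G \<Longrightarrow> \<phi> (inv g) x = y \<longleftrightarrow> \<phi> g y = x"
  by (metis act_act_inv act_inv_act)

lemma act_pow_fixed: "g \<in> carrier G \<Longrightarrow> \<phi> g x = x \<Longrightarrow> \<phi> (g [^] (n::nat)) x = x"
  by (induction n) (simp_all add: act_one act_mult)

section \<open>Expanding elements and the two kinds of crossings\<close>

definition expanding :: "'a \<Rightarrow> ereal \<Rightarrow> ereal \<Rightarrow> bool" where
  "expanding f a b \<longleftrightarrow> f \<in> carrier G \<and> a < b \<and> \<phi> f a = a \<and> \<phi> f b = b \<and>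
     (\<forall>x. a < x \<longrightarrow> x < b \<longrightarrow> x < \<phi> f x)"

text \<open>\<open>expanding\<close> fixes the direction of movement, which
  \<open>fixes_only_ends\<close> leaves open; the inverse of \<open>f\<close> supplies the other
  direction. The two kinds of crossing differ in the end that \<open>g\<close> sends inside, and
  reflection of the line exchanges them.\<close>

definition left_crossing :: "ereal \<Rightarrow> ereal \<Rightarrow> bool" where
  "left_crossing a b \<longleftrightarrow> (\<exists>f. \<exists>g\<in>carrier G. expanding f a b \<and> a < \<phi> g a \<and> \<phi> g a < b)"

definition right_crossing :: "ereal \<Rightarrow> ereal \<Rightarrow> bool" where
  "right_crossing a b \<longleftrightarrow> (\<exists>f. \<exists>g\<in>carrier G. expanding f a b \<and> a < \<phi> g b \<and> \<phi> g b < b)"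

definition crossing :: "ereal \<Rightarrow> ereal \<Rightarrow> bool" where
  "crossing a b \<longleftrightarrow> left_crossing a b \<or> right_crossing a b"

text \<open>Replaces the intermediate value theorem: \<open>p\<close> is the supremum of the points
  of \<open>[x, y]\<close> that \<open>u\<close> does not move to the left.\<close>

lemma last_fixed_point:
  assumes u: "u \<in> carrier G" and "x < y" "x < \<phi> u x" "\<phi> u y < y"
  obtains p where "x < p" "p < y" "\<phi> u p = p" "\<And>z. p < z \<Longrightarrow> z \<le> y \<Longrightarrow> \<phi> u z < z"
proof -
  define p where "p = Sup {z. x \<le> z \<and> z \<le> y \<and> z \<le> \<phi> u z}"
  have up: "z \<le> p" if "x \<le> z" "z \<le> y" "z \<le> \<phi> u z" for z
    unfolding p_def by (rule Sup_upper) (use that in auto)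
  have py: "p \<le> y" unfolding p_def by (rule Sup_least) auto
  have xp: "x \<le> p" using up[of x] assms by auto
  have "p \<le> \<phi> u p"
    unfolding p_def
  proof (rule Sup_least, clarify)
    fix z assume z: "x \<le> z" "z \<le> y" "z \<le> \<phi> u z"
    then have "\<phi> u z \<le> \<phi> u p" using up act_le_iff u by blast
    with z show "z \<le> \<phi> u (Sup {z. x \<le> z \<and> z \<le> y \<and> z \<le> \<phi> u z})" unfolding p_def by simp
  qed
  moreover have "\<phi> u p \<le> p"
  proof (rule ccontr)
    assume "\<not> \<phi> u p \<le> p"
    then have *: "p < \<phi> u p" by simp
    then have "p < y" using py assms by (metis dual_order.strict_trans order_le_imp_less_or_eq less_irrefl)
    \<comment> \<open>A point \<open>w\<close> below both \<open>\<phi> u p\<close> and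
      \<open>y\<close> but above \<open>p\<close> satisfies
      \<open>w < \<phi> u p < \<phi> u w\<close>, so it belongs to the set whose supremum is
      \<open>p\<close>.\<close>
    with * have "p < min (\<phi> u p) y" by simp
    then obtain w where w: "p < w" "w < min (\<phi> u p) y" using dense by blast
    then have "\<phi> u p < \<phi> u w" using act_strict u by blast
    then have "w \<le> p" using w xp by (intro up) (auto simp: order.strict_implies_order)
    with w show False by simp
  qed
  ultimately have "\<phi> u p = p" by simp
  moreover have "\<phi> u z < z" if "p < z" "z \<le> y" for z
    using up[of z] that xp by (meson le_less_trans less_imp_le not_less)
  moreover have "x < p" "p < y" using \<open>\<phi> u p = p\<close> xp py assms by (metis order_le_imp_less_or_eq less_irrefl)+
  ultimately show thesis using that by blast
qed

text \<open>Opposite movements at two interior points would enclose a fixed point; depending on the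
  order of these points, \<open>last_fixed_point\<close> finds it for \<open>f\<close> or for
  \<open>inv f\<close>.\<close>

lemma expanding_or_expanding_inv:
  assumes f: "f \<in> carrier G" "a < b" "\<phi> f a = a" "\<phi> f b = b"
    and nofix: "\<And>x. a < x \<Longrightarrow> x < b \<Longrightarrow> \<phi> f x \<noteq> x"
  shows "expanding f a b \<or> expanding (inv f) a b"
proof (rule ccontr)
  assume "\<not> ?thesis"
  moreover have "\<phi> (inv f) a = a" "\<phi> (inv f) b = b" using f by (simp_all add: act_inv_eq_iff)
  ultimately obtain x y where x: "a < x" "x < b" "\<not> x < \<phi> f x" and y: "a < y" "y < b" "\<not> y < \<phi> (inv f) y"
    using f unfolding expanding_def by auto
  have x': "\<phi> f x < x" using x nofix by (meson not_less_iff_gr_or_eq)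
  have y': "y < \<phi> f y" using y nofix f by (metis less_act_inv_iff not_less_iff_gr_or_eq)
  consider "y < x" | "x < y" using x' y' by fastforce
  then show False
  proof cases
    case 1
    obtain p where "y < p" "p < x" "\<phi> f p = p" using last_fixed_point[OF f(1) 1 y' x'] by blast
    then show False using nofix x y by (meson less_trans)
  next
    case 2
    have "x < \<phi> (inv f) x" "\<phi> (inv f) y < y"
      using x' y' f by (simp_all add: less_act_inv_iff act_inv_less_iff)
    then obtain p where "x < p" "p < y" "\<phi> (inv f) p = p"
      using last_fixed_point[of "inv f"] 2 f by (metis inv_closed)
    then show False using nofix x y f by (metis act_inv_eq_iff less_trans)
  qed
qed

text \<open>The supremum \<open>s\<close> of a forward orbit bounded by \<open>c\<close> would lie
  in \<open>]a, b[\<close> and be moved to the right; then some orbit point already has its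
  successor beyond \<open>s\<close>.\<close>

lemma expanding_orbit:
  assumes "expanding f a b" "a < x" "x < b" "c < b"
  obtains n :: nat where "c < \<phi> (f [^] n) x"
proof (rule ccontr)
  assume "\<not> thesis"
  then have le: "\<phi> (f [^] n) x \<le> c" for n :: nat using that not_less by blast
  define s where "s = (SUP n::nat. \<phi> (f [^] n) x)"
  have up: "\<phi> (f [^] n) x \<le> s" for n :: nat unfolding s_def by (rule SUP_upper) simp
  have f: "f \<in> carrier G" using assms unfolding expanding_def by blast
  have "s \<le> c" unfolding s_def using le by (intro SUP_least) auto
  moreover have "x \<le> s" using up[of 0] by (simp add: act_one)
  ultimately have "s < \<phi> f s" using assms unfolding expanding_def by (meson le_less_trans less_le_trans)
  then have "\<phi> (inv f) s < s" using f by (simp add: act_inv_less_iff)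
  then obtain n :: nat where "\<phi> (inv f) s < \<phi> (f [^] n) x" unfolding s_def by (auto simp: less_SUP_iff)
  then have "s < \<phi> f (\<phi> (f [^] n) x)" using f by (simp add: act_inv_less_iff)
  also have "\<dots> = \<phi> (f [^] Suc n) x" using f by (metis act_mult nat_pow_Suc2 nat_pow_closed)
  finally show False using up[of "Suc n"] by simp
qed

lemma expanding_pow_between:
  assumes "expanding f a b" "a < x" "x < b"
  shows "a < \<phi> (f [^] (n::nat)) x" "\<phi> (f [^] (n::nat)) x < b"
proof -
  have "\<phi> (f [^] n) a = a" "\<phi> (f [^] n) b = b" using assms act_pow_fixed unfolding expanding_def by auto
  then show "a < \<phi> (f [^] n) x" "\<phi> (f [^] n) x < b"
    using assms act_strict[of "f [^] n"] unfolding expanding_def by (metis nat_pow_closed)+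
qed

lemma expanding_conj:
  assumes "expanding f a b" "k \<in> carrier G"
  shows "expanding (k \<otimes> f \<otimes> inv k) (\<phi> k a) (\<phi> k b)"
  using assms unfolding expanding_def
  by (auto simp: act_mult act_less_iff) (metis act_inv_less_iff less_act_inv_iff inv_closed inv_inv)

section \<open>Conjugates and accumulation of crossings\<close>

lemma left_crossing_image:
  assumes "left_crossing a b" "k \<in> carrier G"
  shows "left_crossing (\<phi> k a) (\<phi> k b)"
proof -
  obtain f g where fg: "expanding f a b" "g \<in> carrier G" "a < \<phi> g a" "\<phi> g a < b"
    using assms unfolding left_crossing_def by blast
  have "\<phi> (k \<otimes> g \<otimes> inv k) (\<phi> k a) = \<phi> k (\<phi> g a)" using fg assms by (simp add: act_mult)
  then show ?thesis unfolding left_crossing_def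
    using expanding_conj[OF fg(1) assms(2)] fg assms act_strict
    by (metis inv_closed m_closed)
qed

lemma right_crossing_image:
  assumes "right_crossing a b" "k \<in> carrier G"
  shows "right_crossing (\<phi> k a) (\<phi> k b)"
proof -
  obtain f g where fg: "expanding f a b" "g \<in> carrier G" "a < \<phi> g b" "\<phi> g b < b"
    using assms unfolding right_crossing_def by blast
  have "\<phi> (k \<otimes> g \<otimes> inv k) (\<phi> k b) = \<phi> k (\<phi> g b)" using fg assms by (simp add: act_mult)
  then show ?thesis unfolding right_crossing_def
    using expanding_conj[OF fg(1) assms(2)] fg assms act_strict
    by (metis inv_closed m_closed)
qed

lemma crossing_image: "crossing a b \<Longrightarrow> k \<in> carrier G \<Longrightarrow> crossing (\<phi> k a) (\<phi> k b)"
  unfolding crossing_def using left_crossing_image right_crossing_image by blast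

lemma crossing_expanding:
  assumes "crossing a b" obtains f where "expanding f a b"
  using assms unfolding crossing_def left_crossing_def right_crossing_def by blast

lemma crossing_less: "crossing a b \<Longrightarrow> a < b"
  by (metis crossing_expanding expanding_def)

text \<open>If \<open>g\<close> pulls the right end \<open>b\<close> inside, then \<open>g f\<^sup>n\<close> has a fixed point \<open>p\<close> in \<open>]a, b[\<close> once \<open>n\<close>
  is large, which \<open>f\<close> in turn pushes to the right.\<close>

lemma right_crossing_imp_left_crossing:
  assumes "right_crossing a b"
  obtains p q where "a < p" "p < b" "left_crossing p q"
proof -
  obtain f g where fg: "expanding f a b" "g \<in> carrier G" "a < \<phi> g b" "\<phi> g b < b"
    using assms unfolding right_crossing_def by blast
  have f: "f \<in> carrier G" "\<phi> f b = b" using fg unfolding expanding_def by auto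
  obtain x where x: "a < x" "x < \<phi> g b" using dense fg by blast
  have xb: "x < b" using x fg by order
  have "\<phi> (inv g) x < b" using x fg by (simp add: act_inv_less_iff)
  then obtain n :: nat where "\<phi> (inv g) x < \<phi> (f [^] n) x"
    using expanding_orbit[OF fg(1) x(1) xb] by blast
  then have n: "x < \<phi> g (\<phi> (f [^] n) x)" using fg by (simp add: act_inv_less_iff)
  define u where "u = g \<otimes> f [^] n"
  have u: "u \<in> carrier G" using f fg unfolding u_def by simp
  have "x < \<phi> u x" "\<phi> u b < b" using n f fg by (simp_all add: u_def act_mult act_pow_fixed)
  then obtain p where p: "x < p" "p < b" "\<phi> u p = p" "\<And>z. p < z \<Longrightarrow> z \<le> b \<Longrightarrow> \<phi> u z < z"
    using last_fixed_point[OF u xb] by blast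
  \<comment> \<open>The first fixed point of \<open>u\<close> at or after \<open>b\<close>, possibly
    \<infinity>. The new crossing interval \<open>]p, q[\<close> thus reaches beyond
    \<open>b\<close>.\<close>
  define q where "q = Inf {z. b \<le> z \<and> \<phi> u z = z}"
  have bq: "b \<le> q" unfolding q_def by (rule Inf_greatest) auto
  have low: "q \<le> z" if "b \<le> z" "\<phi> u z = z" for z unfolding q_def by (rule Inf_lower) (use that in auto)
  have q_le: "\<phi> v q \<le> q" if "v = u \<or> v = inv u" for v
  proof -
    have "\<phi> v q \<le> z" if "b \<le> z" "\<phi> u z = z" for z
      using low[OF that] that \<open>v = u \<or> v = inv u\<close> u by (metis act_inv_eq_iff act_le_iff inv_closed)
    then show ?thesis unfolding q_def by (intro Inf_greatest) auto
  qed
  have "\<phi> u q = q" using q_le[of u] q_le[of "inv u"] u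
    by (metis act_act_inv act_le_iff antisym)
  moreover have "\<phi> u z \<noteq> z" if "p < z" "z < q" for z
    using p(4)[of z] low[of z] that by fastforce
  ultimately have "expanding u p q \<or> expanding (inv u) p q"
    using expanding_or_expanding_inv[OF u] p bq by (meson less_le_trans)
  \<comment> \<open>The roles are exchanged: \<open>u\<close> or its inverse is now the expanding
    element, and \<open>f\<close> sends the left end \<open>p\<close> inside.\<close>
  moreover have "p < \<phi> f p" using fg(1) p x unfolding expanding_def by (meson less_trans)
  moreover have "\<phi> f p < q" using act_strict[OF f(1) p(2)] f bq by order
  ultimately have "left_crossing p q" unfolding left_crossing_def using f by blast
  then show thesis using that p x by (meson less_trans)
qed

text \<open>One left crossing with its left end inside \<open>]a, b[\<close> suffices: the image
  under \<open>g\<close> of a left crossing, or else the one from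
  \<open>right_crossing_imp_left_crossing\<close>. Powers of the expanding element then carry this
  end arbitrarily close to \<open>b\<close>.\<close>

lemma left_ends_accumulate:
  assumes "crossing a b" "c < b"
  obtains p q where "c < p" "p < b" "left_crossing p q"
proof -
  have "\<exists>f p q. expanding f a b \<and> a < p \<and> p < b \<and> left_crossing p q"
    using assms(1) unfolding crossing_def
  proof
    assume lc: "left_crossing a b"
    then show ?thesis using left_crossing_image[OF lc] unfolding left_crossing_def[of a b] by blast
  next
    assume rc: "right_crossing a b"
    then show ?thesis using right_crossing_imp_left_crossing crossing_expanding[OF assms(1)] by metis
  qed
  then obtain f p q where f: "expanding f a b" and p: "a < p" "p < b" "left_crossing p q" by blast
  obtain n :: nat where n: "c < \<phi> (f [^] n) p" using expanding_orbit[OF f p(1,2) assms(2)] by blast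
  have "f [^] n \<in> carrier G" using f unfolding expanding_def by simp
  then show thesis using that[OF n] expanding_pow_between[OF f p(1,2)] left_crossing_image[OF p(3)] by blast
qed

section \<open>The ends of the crossing-free interval\<close>

definition alpha :: ereal where
  "alpha = Sup {b. b < 0 \<and> (\<exists>a. crossing a b)}"

definition beta :: ereal where
  "beta = Inf {a. 0 < a \<and> (\<exists>b. crossing a b)}"

lemma alpha_le_0: "alpha \<le> 0"
  unfolding alpha_def by (rule Sup_least) auto

lemma le_alpha: "crossing a b \<Longrightarrow> b < 0 \<Longrightarrow> b \<le> alpha"
  unfolding alpha_def by (rule Sup_upper) auto

lemma beta_le: "crossing a b \<Longrightarrow> 0 < a \<Longrightarrow> beta \<le> a"
  unfolding beta_def by (rule Inf_lower) auto

text \<open>By accumulation at \<open>b\<close>, some left end lies strictly between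
  \<open>0\<close> and \<open>b\<close>; this makes the inequality strict.\<close>

lemma beta_less:
  assumes "crossing a b" "0 < b" shows "beta < b"
proof -
  obtain p q where "0 < p" "p < b" "left_crossing p q" using left_ends_accumulate[OF assms] by blast
  then show ?thesis using beta_le[of p q] unfolding crossing_def by (meson le_less_trans)
qed

text \<open>If \<open>k\<close> moved \<open>alpha\<close> to the right, right ends close to
  \<open>alpha\<close> would be carried into \<open>]alpha, beta[\<close>, against \<open>*\<close>.
  Using this for \<open>h\<close> and its inverse gives equality. The premise \<open>*\<close> is
  later supplied by \<open>crossing_right_end\<close>, and by \<open>crossing_left_end\<close> for
  the reflected action.\<close>

lemma alpha_fixed:
  assumes *: "\<And>a b. crossing a b \<Longrightarrow> alpha < b \<Longrightarrow> beta < b"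
    and h: "h \<in> carrier G" "alpha < \<phi> h 0" "\<phi> h 0 < beta"
    and "alpha < 0" "0 < beta"
  shows "\<phi> h alpha = alpha"
proof -
  have le: "\<phi> k alpha \<le> alpha" if k: "k \<in> carrier G" "\<phi> k alpha < beta" for k
  proof (rule ccontr)
    assume "\<not> \<phi> k alpha \<le> alpha"
    then have "\<phi> (inv k) alpha < alpha" using k by (simp add: act_inv_less_iff)
    then obtain b a where b: "b < 0" "crossing a b" "\<phi> (inv k) alpha < b"
      unfolding less_Sup_iff alpha_def by auto
    have "crossing (\<phi> k a) (\<phi> k b)" using crossing_image b k by blast
    moreover have "alpha < \<phi> k b" using b k by (simp add: act_inv_less_iff)
    moreover have "\<phi> k b \<le> \<phi> k alpha" using le_alpha b k act_le_iff by blast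
    ultimately show False using * k by fastforce
  qed
  have "\<phi> h alpha < \<phi> h 0" using h assms by (simp add: act_less_iff)
  then have "\<phi> h alpha \<le> alpha" using h le[of h] less_trans by blast
  moreover have "\<phi> (inv h) alpha < 0" using h by (simp add: act_inv_less_iff)
  then have "\<phi> (inv h) alpha \<le> alpha" using le[of "inv h"] h assms by (metis inv_closed less_trans)
  ultimately show ?thesis using h act_le_iff by (metis act_act_inv antisym)
qed

section \<open>Reflection of the line\<close>

lemma mirror: "line_action G (\<lambda>g x. - \<phi> g (- x))"
  by unfold_locales (auto simp: act_one act_mult act_strict ereal_minus_less_minus)

end

text \<open>A locale of its own, because interpreting the mirrored action in \<open>line_action\<close> itself would mirror
  it again and again.\<close>

locale mirrored_line_action = line_action begin

sublocale mir: line_action G "\<lambda>g x. - \<phi> g (- x)" by (rule mirror)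

text \<open>The inverse enters because reflection reverses the direction of movement. Since
  \<open>f\<close> is bound existentially in both kinds of crossing, only the ends change their
  roles there.\<close>

lemma mirror_expanding: "mir.expanding f a b \<longleftrightarrow> f \<in> carrier G \<and> expanding (inv f) (- b) (- a)"
proof (cases "f \<in> carrier G")
  case True
  have "(\<forall>x. a < x \<longrightarrow> x < b \<longrightarrow> x < - \<phi> f (- x)) \<longleftrightarrow>
        (\<forall>x. - b < x \<longrightarrow> x < - a \<longrightarrow> \<phi> f x < x)"
    by (metis ereal_minus_less_minus ereal_uminus_uminus)
  then show ?thesis using True
    unfolding mir.expanding_def expanding_def
    by (auto simp: act_inv_eq_iff less_act_inv_iff ereal_uminus_eq_reorder)
qed (simp add: mir.expanding_def)

lemma mirror_expanding_ex: "(\<exists>f. mir.expanding f a b) \<longleftrightarrow> (\<exists>f. expanding f (- b) (- a))"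
  unfolding mirror_expanding by (metis expanding_def inv_closed inv_inv)

lemma mirror_left_crossing: "mir.left_crossing a b \<longleftrightarrow> right_crossing (- b) (- a)"
  unfolding mir.left_crossing_def right_crossing_def using mirror_expanding_ex[of a b]
  by (metis ereal_minus_less_minus ereal_uminus_uminus)

lemma mirror_right_crossing: "mir.right_crossing a b \<longleftrightarrow> left_crossing (- b) (- a)"
  unfolding mir.right_crossing_def left_crossing_def using mirror_expanding_ex[of a b]
  by (metis ereal_minus_less_minus ereal_uminus_uminus)

lemma mirror_crossing: "mir.crossing a b \<longleftrightarrow> crossing (- b) (- a)"
  unfolding mir.crossing_def crossing_def mirror_left_crossing mirror_right_crossing by blast

lemma right_ends_accumulate:
  assumes "crossing a b" "a < c"
  obtains p q where "a < p" "p < c" "right_crossing q p"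
proof -
  have "mir.crossing (- b) (- a)" "- c < - a" using assms by (simp_all add: mirror_crossing)
  then obtain p q where "- c < p" "p < - a" "mir.left_crossing p q" by (rule mir.left_ends_accumulate)
  then show thesis using that[of "- p" "- q"] mirror_left_crossing
    by (metis ereal_minus_less_minus ereal_uminus_uminus)
qed

lemma mirror_alpha: "mir.alpha = - beta"
proof -
  have "{b. b < 0 \<and> (\<exists>a. mir.crossing a b)} = uminus ` {a. 0 < a \<and> (\<exists>b. crossing a b)}"
    unfolding mirror_crossing image_Collect
    by (intro Collect_cong) (metis ereal_minus_less_minus ereal_uminus_uminus ereal_uminus_zero)
  then show ?thesis unfolding mir.alpha_def beta_def by (simp add: ereal_Sup_uminus_image_eq)
qed

lemma mirror_beta: "mir.beta = - alpha"
proof -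
  have "{a. 0 < a \<and> (\<exists>b. mir.crossing a b)} = uminus ` {b. b < 0 \<and> (\<exists>a. crossing a b)}"
    unfolding mirror_crossing image_Collect
    by (intro Collect_cong) (metis ereal_minus_less_minus ereal_uminus_uminus ereal_uminus_zero)
  then show ?thesis unfolding mir.beta_def alpha_def by (simp add: ereal_Inf_uminus_image_eq)
qed

section \<open>Positions of crossing ends relative to \<open>alpha\<close> and
  \<open>beta\<close>\<close>

lemma beta_ge_0: "0 \<le> beta"
  using mir.alpha_le_0 unfolding mirror_alpha by simp

lemma less_alpha:
  assumes "crossing a b" "a < 0" shows "a < alpha"
  using mir.beta_less[of "- b" "- a"] assms by (simp add: mirror_crossing mirror_beta)

text \<open>For \<open>b\<close> \<le> \<open>0\<close>, left ends accumulate at \<open>b\<close>;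
  those in \<open>]alpha, b[\<close> are negative, whereas \<open>less_alpha\<close> places every
  negative left end below \<open>alpha\<close>.\<close>

lemma crossing_right_end:
  assumes "crossing a b" "alpha < 0" "alpha < b"
  shows "beta < b"
proof (cases "0 < b")
  case True
  then show ?thesis using beta_less assms by blast
next
  case False
  obtain p q where p: "alpha < p" "p < b" "left_crossing p q"
    using left_ends_accumulate[OF assms(1,3)] by blast
  then have "p < alpha" using less_alpha[of p q] False unfolding crossing_def by force
  then show ?thesis using p by order
qed

lemma crossing_left_end:
  assumes "crossing a b" "0 < beta" "a < beta"
  shows "a < alpha"
proof (cases "a < 0")
  case True
  then show ?thesis using less_alpha assms by blast
next
  case False
  obtain p q where p: "a < p" "p < beta" "right_crossing q p"
    using right_ends_accumulate[OF assms(1,3)] by blast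
  then have "beta < p" using beta_less[of q p] False unfolding crossing_def by force
  then show ?thesis using p by order
qed

lemma beta_fixed:
  assumes h: "h \<in> carrier G" "alpha < \<phi> h 0" "\<phi> h 0 < beta" and "alpha < 0" "0 < beta"
  shows "\<phi> h beta = beta"
proof -
  have "- \<phi> h (- mir.alpha) = mir.alpha"
    using assms crossing_left_end
    by (intro mir.alpha_fixed) (auto simp: mirror_alpha mirror_beta mirror_crossing ereal_uminus_less_reorder ereal_less_uminus_reorder)
  then show ?thesis by (simp add: mirror_alpha)
qed

section \<open>The stabilizer of both ends\<close>

definition end_stabilizer :: "'a set" where
  "end_stabilizer = {g \<in> carrier G. \<phi> g alpha = alpha \<and> \<phi> g beta = beta}"

lemma subgroup_end_stabilizer: "subgroup end_stabilizer G"
  by (rule subgroupI) (auto simp: end_stabilizer_def act_one act_mult act_inv_eq_iff intro: exI[of _ \<one>])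

lemma end_stabilizer_between:
  assumes "alpha < 0" "0 < beta" "g \<in> end_stabilizer"
  shows "alpha < \<phi> g 0" "\<phi> g 0 < beta"
  using assms act_strict unfolding end_stabilizer_def by (metis (mono_tags, lifting) mem_Collect_eq)+

text \<open>Together with \<open>end_stabilizer_between\<close>: unless an end is \<open>0\<close>,
  the stabilizer consists of the elements whose orbit point lies in \<open>]alpha, beta[\<close>.
  Its convexity comes from here.\<close>

lemma between_end_stabilizer:
  assumes "alpha < 0" "0 < beta" "g \<in> carrier G" "alpha < \<phi> g 0" "\<phi> g 0 < beta"
  shows "g \<in> end_stabilizer"
  unfolding end_stabilizer_def
  using assms alpha_fixed[OF crossing_right_end] beta_fixed by auto

end

section \<open>The Conradian soul of an action\<close>

text \<open>The orbit of \<open>0\<close> displays the order, and \<open>gap_fixed\<close> abstracts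
  from affinity on the complementary intervals of the orbit closure. The latter guarantees an orbit
  point inside every crossing.\<close>

locale ordered_line_action = mirrored_line_action +
  fixes r :: "('a \<times> 'a) set"
  assumes less_iff: "g \<in> carrier G \<Longrightarrow> h \<in> carrier G \<Longrightarrow> strictly_below r g h \<longleftrightarrow> \<phi> g 0 < \<phi> h 0"
    and free: "g \<in> carrier G \<Longrightarrow> \<phi> g 0 = 0 \<Longrightarrow> g = \<one>"
    and gap_fixed: "f \<in> carrier G \<Longrightarrow> \<phi> f a = a \<Longrightarrow> \<phi> f b = b \<Longrightarrow> a < x \<Longrightarrow> x < b \<Longrightarrow>
      (\<And>k. k \<in> carrier G \<Longrightarrow> \<not> (a < \<phi> k 0 \<and> \<phi> k 0 < b)) \<Longrightarrow> \<phi> f x = x"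
begin

section \<open>The end stabilizer is convex and Conradian\<close>

lemma order_convex_end_stabilizer: "order_convex G r end_stabilizer"
  unfolding order_convex_def
proof (intro ballI impI)
  fix f g h assume fg: "f \<in> end_stabilizer" "g \<in> end_stabilizer" and h: "h \<in> carrier G"
    and "strictly_below r f h" "strictly_below r h g"
  moreover have c: "f \<in> carrier G" "g \<in> carrier G" using fg unfolding end_stabilizer_def by auto
  ultimately have lt: "\<phi> f 0 < \<phi> h 0" "\<phi> h 0 < \<phi> g 0" using less_iff by auto
  show "h \<in> end_stabilizer"
  proof (cases "alpha < 0 \<and> 0 < beta")
    case True
    then show ?thesis using end_stabilizer_between fg between_end_stabilizer h lt by (meson less_trans)
  next
    \<comment> \<open>In the degenerate case an end is \<open>0\<close>, so the stabilizer fixes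
      \<open>0\<close> and nothing lies strictly between its orbit points.\<close>
    case False
    then have "alpha = 0 \<or> beta = 0" using alpha_le_0 beta_ge_0 by (simp add: less_le)
    then have "\<phi> f 0 = 0" "\<phi> g 0 = 0" using fg unfolding end_stabilizer_def by auto
    then show ?thesis using lt by simp
  qed
qed

text \<open>The interval runs from the last fixed point at or before \<open>x\<close> to the limit
  of the forward orbit. A fixed point strictly inside would lie beyond \<open>x\<close> and bound
  this orbit below \<open>p\<close>.\<close>

lemma expanding_if_escaping:
  assumes g: "g \<in> carrier G" and x: "x < \<phi> g x"
  defines "p \<equiv> SUP n::nat. \<phi> (g [^] n) x"
  defines "a \<equiv> Sup {y. y \<le> x \<and> \<phi> g y = y}"
  shows "expanding g a p" "x < p" "a < x"
proof -
  have le_p: "\<phi> (g [^] n) x \<le> p" for n :: nat unfolding p_def by (rule SUP_upper) simp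
  have pow_Suc: "\<phi> (g [^] Suc n) x = \<phi> g (\<phi> (g [^] n) x)" for n :: nat
    using g by (metis act_mult nat_pow_Suc2 nat_pow_closed)
  show xp: "x < p" using x le_p[of 1] g by (simp add: act_one)
  have sup: "\<exists>n::nat. y < \<phi> (g [^] n) x" if "y < p" for y
    using that unfolding p_def less_SUP_iff by auto
  have p1: "p \<le> \<phi> g p"
  proof (rule ccontr)
    assume "\<not> p \<le> \<phi> g p"
    then obtain n :: nat where "\<phi> g p < \<phi> (g [^] n) x" using sup by force
    moreover have "\<phi> (g [^] n) x \<le> \<phi> g p" for n :: nat
    proof (cases n)
      case 0
      have "x \<le> \<phi> g x" using x by simp
      also have "\<dots> \<le> \<phi> g p" using g xp by (simp add: act_le_iff)
      finally show ?thesis using 0 by (simp add: act_one)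
    next
      case (Suc m)
      then show ?thesis using pow_Suc[of m] le_p[of m] g by (simp only: act_le_iff)
    qed
    ultimately show False using not_less by blast
  qed
  have p2: "\<phi> g p \<le> p"
  proof (rule ccontr)
    assume "\<not> \<phi> g p \<le> p"
    then have "\<phi> (inv g) p < p" using g by (simp add: act_inv_less_iff)
    then obtain n :: nat where "\<phi> (inv g) p < \<phi> (g [^] n) x" using sup by blast
    then have "p < \<phi> (g [^] Suc n) x" using g unfolding pow_Suc by (simp add: act_inv_less_iff)
    then show False using le_p[of "Suc n"] by simp
  qed
  have gp: "\<phi> g p = p" using p1 p2 by simp
  have ax: "a \<le> x" unfolding a_def by (rule Sup_least) auto
  have up: "y \<le> a" if "y \<le> x" "\<phi> g y = y" for y unfolding a_def by (rule Sup_upper) (use that in auto)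
  have a_ge: "a \<le> \<phi> k a" if "k = g \<or> k = inv g" for k
  proof -
    have "y \<le> \<phi> k a" if "y \<le> x" "\<phi> g y = y" for y
      using up[OF that] that \<open>k = g \<or> k = inv g\<close> g by (metis act_inv_eq_iff act_le_iff inv_closed)
    then show ?thesis using a_def by (auto intro: Sup_least)
  qed
  have ga: "\<phi> g a = a" using a_ge[of g] a_ge[of "inv g"] g by (metis act_act_inv act_le_iff antisym)
  then show ax': "a < x" using x ax by (metis less_le)
  have nofix: "\<phi> g y \<noteq> y" if y: "a < y" "y < p" for y
  proof
    assume y_fixed: "\<phi> g y = y"
    then have "x < y" using up[of y] y by force
    moreover obtain n :: nat where "y < \<phi> (g [^] n) x" using sup y by blast
    moreover have "\<phi> (g [^] n) y = y" using act_pow_fixed[OF g y_fixed] .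
    ultimately show False using act_strict[of "g [^] n" x y] g by force
  qed
  have "\<not> expanding (inv g) a p"
    using x xp ax' g unfolding expanding_def by (metis less_act_inv_iff less_asym')
  then show "expanding g a p"
    using expanding_or_expanding_inv[OF g _ ga gp nofix] xp ax' by auto
qed

text \<open>A violation bounds \<open>f g^n 0\<close> by \<open>g 0\<close> for all
  \<open>n\<close>, so in the limit \<open>f\<close> sends \<open>p\<close> into
  \<open>]a, p[\<close>. This right crossing with \<open>0 < p\<close> \<le> \<open>beta\<close>
  contradicts \<open>beta_less\<close>.\<close>

lemma conradian_end_stabilizer: "conradian_on G r end_stabilizer"
  unfolding conradian_on_def
proof (intro ballI impI, rule ccontr)
  fix f g assume fg: "f \<in> end_stabilizer" "g \<in> end_stabilizer"
    and "strictly_below r \<one> f" "strictly_below r \<one> g"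
    and no: "\<nexists>n::nat. strictly_below r g (f \<otimes> g [^] n)"
  moreover have c: "f \<in> carrier G" "g \<in> carrier G" using fg unfolding end_stabilizer_def by auto
  ultimately have pos: "0 < \<phi> f 0" "0 < \<phi> g 0" by (auto simp: less_iff act_one)
  \<comment> \<open>If an end were \<open>0\<close>, the stabilizer would fix \<open>0\<close>, but
    \<open>f\<close> moves it.\<close>
  have ab: "alpha < 0" "0 < beta"
    using pos fg alpha_le_0 beta_ge_0 unfolding end_stabilizer_def by (auto simp: less_le)
  have le: "\<phi> f (\<phi> (g [^] n) 0) \<le> \<phi> g 0" for n :: nat
    using no c by (auto simp: less_iff act_mult not_less)
  define p where "p = (SUP n::nat. \<phi> (g [^] n) 0)"
  define a where "a = Sup {y. y \<le> 0 \<and> \<phi> g y = y}"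
  have ap: "expanding g a p" "0 < p" "a < 0"
    unfolding p_def a_def using expanding_if_escaping[OF c(2) pos(2)] by auto
  have "p \<le> beta" unfolding p_def
  proof (rule SUP_least)
    fix n :: nat
    have "\<phi> (g [^] n) beta = beta" using fg act_pow_fixed unfolding end_stabilizer_def by auto
    then show "\<phi> (g [^] n) 0 \<le> beta" using act_strict[of "g [^] n" 0 beta] c ab by simp
  qed
  \<comment> \<open>Passage to the supremum, with \<open>inv f\<close> in place of continuity of
    \<open>f\<close>.\<close>
  have "\<phi> f p \<le> \<phi> g 0"
  proof (rule ccontr)
    assume "\<not> \<phi> f p \<le> \<phi> g 0"
    then have "\<phi> (inv f) (\<phi> g 0) < p" using c by (simp add: act_inv_less_iff)
    then obtain n :: nat where "\<phi> (inv f) (\<phi> g 0) < \<phi> (g [^] n) 0" unfolding p_def by (auto simp: less_SUP_iff)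
    then show False using le[of n] c by (simp add: act_inv_less_iff)
  qed
  moreover have "\<phi> g 0 < p" using expanding_pow_between(2)[OF ap(1,3,2), of 1] c by simp
  moreover have "\<phi> f 0 < \<phi> f p" using ap c by (simp add: act_strict)
  ultimately have "right_crossing a p"
    unfolding right_crossing_def using ap c pos by (intro exI[of _ g] bexI[of _ f]) auto
  then have "beta < p" using beta_less[of a p] ap unfolding crossing_def by blast
  then show False using \<open>p \<le> beta\<close> by simp
qed

section \<open>Convex Conradian subgroups fix both ends\<close>

lemma subgroup_pow_closed: "subgroup H G \<Longrightarrow> f \<in> H \<Longrightarrow> f [^] (n::nat) \<in> H"
  by (induction n) (auto simp: subgroup.one_closed subgroup.m_closed)

text \<open>\<open>p\<close> and \<open>q\<close> bound the hull of the orbit of \<open>0\<close>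
  under \<open>H\<close>. By convexity, elements sending a hull point to a hull point belong to
  \<open>H\<close>, so the Conradian property excludes crossing ends there; then \<open>H\<close>
  preserves the sets of crossing ends that define \<open>alpha\<close> and
  \<open>beta\<close>.\<close>

lemma subgroup_subset_end_stabilizer:
  assumes H: "subgroup H G" and conv: "order_convex G r H" and conr: "conradian_on G r H"
  shows "H \<subseteq> end_stabilizer"
proof (cases "H = {\<one>}")
  case True
  then show ?thesis using subgroup.one_closed[OF subgroup_end_stabilizer] by simp
next
  case False
  have HG: "h \<in> carrier G" if "h \<in> H" for h using that H by (rule subgroup.mem_carrier[rotated])
  have Hinv: "inv h \<in> H" if "h \<in> H" for h using that H by (simp add: subgroup.m_inv_closed)
  have Hm: "h \<otimes> k \<in> H" if "h \<in> H" "k \<in> H" for h k using that H by (simp add: subgroup.m_closed)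
  have H1: "\<one> \<in> H" using H by (rule subgroup.one_closed)
  define p where "p = (INF h\<in>H. \<phi> h 0)"
  define q where "q = (SUP h\<in>H. \<phi> h 0)"
  have p_le: "p \<le> \<phi> h 0" and le_q: "\<phi> h 0 \<le> q" if "h \<in> H" for h
    unfolding p_def q_def using that by (auto intro: INF_lower SUP_upper)
  obtain h0 where h0: "h0 \<in> H" "\<phi> h0 0 \<noteq> 0" using False H1 free HG by blast
  have "\<exists>k\<in>H. 0 < \<phi> k 0"
    using h0 Hinv HG by (metis less_act_inv_iff not_less_iff_gr_or_eq)
  then obtain k where k: "k \<in> H" "0 < \<phi> k 0" by blast
  then have "\<phi> (inv k) 0 < 0" using HG by (simp add: act_inv_less_iff)
  then have p0: "p < 0" using p_le[of "inv k"] Hinv k by (meson le_less_trans)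
  have q0: "0 < q" using le_q k by (meson less_le_trans)
  have ex: "\<exists>h\<in>H. \<phi> h 0 < y" if "p < y" for y using that unfolding p_def INF_less_iff by auto
  have ex': "\<exists>h\<in>H. y < \<phi> h 0" if "y < q" for y using that unfolding q_def less_SUP_iff by auto
  have mem: "g \<in> H" if g: "g \<in> carrier G" "p < \<phi> g 0" "\<phi> g 0 < q" for g
  proof -
    obtain h1 h2 where "h1 \<in> H" "\<phi> h1 0 < \<phi> g 0" "h2 \<in> H" "\<phi> g 0 < \<phi> h2 0" using ex ex' g by blast
    then show ?thesis using conv g HG less_iff unfolding order_convex_def by blast
  qed
  \<comment> \<open>The point \<open>y\<close> need not be an orbit point, so it is enclosed by two
    of them. If neither is sent into the hull, \<open>g\<close> stretches the enclosed interval over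
    the whole hull, and \<open>inv g\<close> sends \<open>0\<close> into that interval.\<close>
  have mem': "g \<in> H" if g: "g \<in> carrier G" and y: "p < y" "y < q" "p < \<phi> g y" "\<phi> g y < q" for g y
  proof -
    obtain h1 h2 where h: "h1 \<in> H" "\<phi> h1 0 < y" "h2 \<in> H" "y < \<phi> h2 0" using ex ex' y by blast
    have c: "h1 \<in> carrier G" "h2 \<in> carrier G" using h HG by auto
    have lt: "\<phi> g (\<phi> h1 0) < q" "p < \<phi> g (\<phi> h2 0)" using act_strict[OF g h(2)] act_strict[OF g h(4)] y by order+
    have div: "g \<in> H" if "h \<in> H" "g \<otimes> h \<in> H" for h
      using Hm[OF that(2) Hinv[OF that(1)]] g HG[OF that(1)] by (simp add: m_assoc)
    show ?thesis
    proof (cases "p < \<phi> g (\<phi> h1 0) \<or> \<phi> g (\<phi> h2 0) < q")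
      case True
      then have "g \<otimes> h1 \<in> H \<or> g \<otimes> h2 \<in> H"
        using mem[of "g \<otimes> h1"] mem[of "g \<otimes> h2"] lt c g by (auto simp: act_mult)
      then show ?thesis using div h by blast
    next
      case False
      then have "\<phi> g (\<phi> h1 0) < 0" "0 < \<phi> g (\<phi> h2 0)" using p0 q0 by auto
      then have "\<phi> h1 0 < \<phi> (inv g) 0" "\<phi> (inv g) 0 < \<phi> h2 0"
        using g by (simp_all add: act_inv_less_iff less_act_inv_iff)
      then have "inv g \<in> H" using mem[of "inv g"] p_le le_q h g by (meson inv_closed le_less_trans less_le_trans)
      then show ?thesis using Hinv g by (metis inv_inv)
    qed
  qed
  have p_fixed: "\<phi> h p = p" if h: "h \<in> H" for h
  proof -
    have le: "\<phi> h p \<le> p" if "h \<in> H" for h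
      unfolding p_def
    proof (rule INF_greatest)
      fix k assume "k \<in> H"
      then have "p \<le> \<phi> (inv h \<otimes> k) 0" using that Hm Hinv p_le by blast
      then have "p \<le> \<phi> (inv h) (\<phi> k 0)" using that \<open>k \<in> H\<close> HG by (simp add: act_mult)
      then have "\<phi> h p \<le> \<phi> k 0" using that HG by (metis act_act_inv act_le_iff)
      then show "\<phi> h (INF h\<in>H. \<phi> h 0) \<le> \<phi> k 0" unfolding p_def .
    qed
    then show ?thesis using le[of h] le[of "inv h"] h HG Hinv
      by (metis act_act_inv act_le_iff antisym)
  qed
  \<comment> \<open>As \<open>f\<close> fixes the hull point \<open>b\<close>, it lies in
    \<open>H\<close> and fixes \<open>p\<close>, but it has no fixed point strictly between
    \<open>a\<close> and \<open>b\<close>.\<close>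
  have left_end: "p \<le> a" if f: "expanding f a b" and b: "p < b" "b < q" for f a b
  proof (rule ccontr)
    assume "\<not> p \<le> a"
    moreover have "\<phi> f b = b" "f \<in> carrier G" using f unfolding expanding_def by auto
    then have "\<phi> f p = p" using mem'[of f b] b p_fixed by simp
    ultimately show False using f b unfolding expanding_def by (metis less_irrefl not_le)
  qed
  have no_right_crossing: False if rc: "right_crossing a b" and b: "p < b" "b < q" for a b
  proof -
    obtain f g where f: "expanding f a b" and g: "g \<in> carrier G" "a < \<phi> g b" "\<phi> g b < b"
      using rc unfolding right_crossing_def by blast
    have pa: "p \<le> a" using left_end f b by blast
    have fc: "f \<in> carrier G" "\<phi> f a = a" "\<phi> f b = b" "a < b" using f unfolding expanding_def by auto
    have fH: "f \<in> H" using mem'[of f b] b fc by simp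
    have gH: "g \<in> H" using mem'[of g b] b g pa by (meson le_less_trans less_trans)
    obtain x where x: "a < x" "x < b" using fc dense by blast
    \<comment> \<open>Since \<open>f\<close> moves interior points, \<open>gap_fixed\<close> yields
      an orbit point in the interval; it serves as base point in place of \<open>0\<close>.\<close>
    have "\<phi> f x \<noteq> x" using f x unfolding expanding_def by force
    then obtain k where k: "k \<in> carrier G" "a < \<phi> k 0" "\<phi> k 0 < b" using gap_fixed[OF fc(1-3) x] by blast
    then have kH: "k \<in> H" using mem pa b by (meson le_less_trans less_trans)
    \<comment> \<open>First \<open>f [^] m\<close> brings \<open>\<phi> k 0\<close> so close to
      \<open>b\<close> that \<open>g\<close> keeps it above \<open>a\<close>; then
      \<open>f [^] j\<close> pushes the result beyond \<open>\<phi> k 0\<close>.\<close>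
    obtain m :: nat where "\<phi> (inv g) a < \<phi> (f [^] m) (\<phi> k 0)"
      using expanding_orbit[OF f k(2,3), of "\<phi> (inv g) a"] g by (auto simp: act_inv_less_iff)
    then have m: "a < \<phi> g (\<phi> (f [^] m) (\<phi> k 0))" using g by (simp add: act_inv_less_iff)
    have fm: "\<phi> (f [^] m) (\<phi> k 0) < b" using expanding_pow_between[OF f k(2,3)] by blast
    have m': "\<phi> g (\<phi> (f [^] m) (\<phi> k 0)) < b" using act_strict[OF g(1) fm] g by order
    obtain j :: nat where j: "\<phi> k 0 < \<phi> (f [^] j) (\<phi> g (\<phi> (f [^] m) (\<phi> k 0)))"
      using expanding_orbit[OF f m m' k(3)] by blast
    define F where "F = f [^] j \<otimes> g \<otimes> f [^] m"
    have FH: "F \<in> H" unfolding F_def using fH gH Hm subgroup_pow_closed[OF H] by blast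
    have Fk: "\<phi> k 0 < \<phi> F (\<phi> k 0)" using j g fc by (simp add: F_def act_mult)
    have "\<phi> F b = \<phi> (f [^] j) (\<phi> g b)" using g fc by (simp add: F_def act_mult act_pow_fixed)
    then have Fb: "\<phi> F b < b" using expanding_pow_between[OF f g(2,3)] by simp
    obtain i :: nat where i: "\<phi> F b < \<phi> (f [^] i) (\<phi> k 0)" using expanding_orbit[OF f k(2,3) Fb] by blast
    define u where "u = f [^] i"
    have uH: "u \<in> H" unfolding u_def using fH subgroup_pow_closed[OF H] by blast
    have u_fixed: "\<phi> u b = b" unfolding u_def using fc act_pow_fixed by blast
    \<comment> \<open>Conjugation by \<open>k\<close>, itself in \<open>H\<close>, moves the base
      point back to \<open>0\<close> and stays in \<open>H\<close>, where the Conradian property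
      applies.\<close>
    define F' where "F' = inv k \<otimes> F \<otimes> k"
    define u' where "u' = inv k \<otimes> u \<otimes> k"
    note c = HG[OF FH] HG[OF uH] k(1)
    have c': "F' \<in> H" "u' \<in> H" unfolding F'_def u'_def using kH FH uH Hm Hinv by auto
    have actk: "\<phi> F' y = \<phi> (inv k) (\<phi> F (\<phi> k y))" "\<phi> u' y = \<phi> (inv k) (\<phi> u (\<phi> k y))" for y
      unfolding F'_def u'_def using c by (simp_all add: act_mult)
    have F'0: "0 < \<phi> F' 0" using Fk c by (simp add: actk less_act_inv_iff)
    have "\<phi> F (\<phi> k 0) < \<phi> F b" using k c by (simp add: act_strict)
    with Fk i have "\<phi> k 0 < \<phi> u (\<phi> k 0)" unfolding u_def by order
    then have "0 < \<phi> u' 0" using c by (simp add: actk less_act_inv_iff)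
    then have "strictly_below r \<one> F'" "strictly_below r \<one> u'"
      using F'0 c' HG by (simp_all add: less_iff act_one)
    then obtain n :: nat where "strictly_below r u' (F' \<otimes> u' [^] n)"
      using conr c' unfolding conradian_on_def by blast
    then have "\<phi> u' 0 < \<phi> (F' \<otimes> u' [^] n) 0" using c' HG by (simp add: less_iff)
    then have "\<phi> u' 0 < \<phi> F' (\<phi> (u' [^] n) 0)" using c' HG by (simp add: act_mult)
    then have lt: "\<phi> u (\<phi> k 0) < \<phi> F (\<phi> k (\<phi> (u' [^] n) 0))" using c by (simp add: actk act_less_iff)
    \<comment> \<open>The iterates stay below the fixed point \<open>b\<close> of \<open>u\<close>,
      so \<open>F\<close> sends them below \<open>\<phi> F b\<close>, hence below
      \<open>\<phi> u (\<phi> k 0)\<close> by the choice of \<open>i\<close>.\<close>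
    have "\<phi> k (\<phi> (u' [^] n) 0) < b"
    proof (induction n)
      case 0
      then show ?case using k by (simp add: act_one)
    next
      case (Suc n)
      have "\<phi> (u' [^] Suc n) 0 = \<phi> u' (\<phi> (u' [^] n) 0)"
        using c' HG by (metis act_mult nat_pow_Suc2 nat_pow_closed)
      then show ?case using act_strict[OF c(2) Suc] u_fixed c by (simp add: actk)
    qed
    then have "\<phi> F (\<phi> k (\<phi> (u' [^] n) 0)) < \<phi> F b" using c by (simp add: act_strict)
    then show False using lt i unfolding u_def by order
  qed
  \<comment> \<open>A crossing of either kind with right end in \<open>]p, 0[\<close> has its left
    end at or after \<open>p\<close>, and the right crossings whose right ends accumulate there
    contradict \<open>no_right_crossing\<close>.\<close>
  have b_le: "b \<le> p" if cr: "crossing a b" and "b < 0" for a b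
  proof (rule ccontr)
    assume "\<not> b \<le> p"
    then have b: "p < b" "b < q" using that q0 by auto
    obtain f where f: "expanding f a b" using crossing_expanding cr by blast
    have pa: "p \<le> a" using left_end f b by blast
    obtain p' q' where "a < p'" "p' < b" "right_crossing q' p'"
      using right_ends_accumulate[OF cr] crossing_less[OF cr] by blast
    then show False using no_right_crossing pa b by (meson le_less_trans less_trans)
  qed
  have q_le: "q \<le> a" if cr: "crossing a b" and "0 < a" for a b
  proof (rule ccontr)
    assume "\<not> q \<le> a"
    then have "a < q" by simp
    then obtain p' q' where "a < p'" "p' < q" "right_crossing q' p'"
      by (rule right_ends_accumulate[OF cr])
    then show False using no_right_crossing p0 that by (meson less_trans)
  qed
  \<comment> \<open>Right ends below \<open>0\<close> lie at or below the fixed point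
    \<open>p\<close>, so \<open>H\<close> carries them to right ends below \<open>0\<close>.
    Inverses later provide the opposite inequality.\<close>
  have alpha_le: "alpha \<le> \<phi> h alpha" if h: "h \<in> H" for h
  proof -
    have "b \<le> \<phi> h alpha" if b: "b < 0" "crossing a b" for a b
    proof -
      have "\<phi> (inv h) b \<le> \<phi> (inv h) p" using b_le b h HG by (simp add: act_le_iff)
      then have "\<phi> (inv h) b < 0" using p_fixed[OF Hinv[OF h]] p0 by simp
      then have "\<phi> (inv h) b \<le> alpha" using le_alpha crossing_image b h HG by (metis inv_closed)
      then show ?thesis using h HG by (metis act_act_inv act_le_iff)
    qed
    then show ?thesis unfolding alpha_def[symmetric] using alpha_def by (auto intro: Sup_least)
  qed
  have q_mono: "q \<le> \<phi> h q" if h: "h \<in> H" for h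
    unfolding q_def
  proof (rule SUP_least)
    fix k assume k: "k \<in> H"
    then have "\<phi> (inv h \<otimes> k) 0 \<le> q" using h Hm Hinv le_q by blast
    then have "\<phi> (inv h) (\<phi> k 0) \<le> q" using h k HG by (simp add: act_mult)
    then have "\<phi> k 0 \<le> \<phi> h q" using h HG by (metis act_act_inv act_le_iff)
    then show "\<phi> k 0 \<le> \<phi> h (SUP h\<in>H. \<phi> h 0)" unfolding q_def .
  qed
  have le_beta: "\<phi> h beta \<le> beta" if h: "h \<in> H" for h
  proof -
    have "\<phi> h beta \<le> a" if a: "0 < a" "crossing a b" for a b
    proof -
      have "\<phi> (inv h) q \<le> \<phi> (inv h) a" using q_le a h HG by (simp add: act_le_iff)
      then have "0 < \<phi> (inv h) a" using q_mono[OF Hinv[OF h]] q0 by order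
      then have "beta \<le> \<phi> (inv h) a" using beta_le crossing_image a h HG by (metis inv_closed)
      then show ?thesis using h HG by (metis act_act_inv act_le_iff)
    qed
    then show ?thesis using beta_def by (auto intro: Inf_greatest)
  qed
  have "\<phi> h alpha = alpha" "\<phi> h beta = beta" if h: "h \<in> H" for h
    using alpha_le[OF h] alpha_le[OF Hinv[OF h]] le_beta[OF h] le_beta[OF Hinv[OF h]] h HG
    by (metis act_act_inv act_le_iff antisym)+
  then show ?thesis unfolding end_stabilizer_def using HG by blast
qed

theorem conradian_soul_eq: "conradian_soul G r = end_stabilizer"
  unfolding conradian_soul_def
  by (rule Greatest_equality)
    (use subgroup_end_stabilizer order_convex_end_stabilizer conradian_end_stabilizer
      subgroup_subset_end_stabilizer in auto)

end

section \<open>The orbit of the dynamical realization\<close>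

declare index_pos.simps(2) [simp del]

lemma strictly_below_irrefl [simp]: "\<not> strictly_below r x x"
  unfolding strictly_below_def by simp

lemma finite_maximal:
  fixes f :: "'b \<Rightarrow> 'c :: linorder"
  assumes "finite S" "S \<noteq> {}"
  obtains m where "m \<in> S" "\<And>j. j \<in> S \<Longrightarrow> f j \<le> f m"
proof -
  have "Max (f ` S) \<in> f ` S" using assms by simp
  then obtain m where "m \<in> S" "f m = Max (f ` S)" by auto
  then show thesis using that assms(1) by simp
qed

lemma finite_minimal:
  fixes f :: "'b \<Rightarrow> 'c :: linorder"
  assumes "finite S" "S \<noteq> {}"
  obtains m where "m \<in> S" "\<And>j. j \<in> S \<Longrightarrow> f m \<le> f j"
proof -
  have "Min (f ` S) \<in> f ` S" using assms by simp
  then obtain m where "m \<in> S" "f m = Min (f ` S)" by auto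
  then show thesis using that assms(1) by simp
qed

section \<open>Left-ordered groups\<close>

locale left_ordered_group = group G for G :: "('a, 'm) monoid_scheme" (structure) +
  fixes r :: "('a \<times> 'a) set"
  assumes left_invariant: "left_invariant_order G r"
begin

abbreviation below (infix "\<sqsubset>" 50) where "x \<sqsubset> y \<equiv> strictly_below r x y"

lemma below_trans: "x \<sqsubset> y \<Longrightarrow> y \<sqsubset> z \<Longrightarrow> x \<sqsubset> z"
  using left_invariant
  unfolding strictly_below_def left_invariant_order_def order_on_defs
  by (metis antisymD transD)

lemma below_asym: "x \<sqsubset> y \<Longrightarrow> \<not> y \<sqsubset> x"
  using below_trans strictly_below_irrefl by metis

lemma below_total: "x \<in> carrier G \<Longrightarrow> y \<in> carrier G \<Longrightarrow> x \<noteq> y \<Longrightarrow> x \<sqsubset> y \<or> y \<sqsubset> x"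
  using left_invariant
  unfolding strictly_below_def left_invariant_order_def order_on_defs total_on_def by blast

lemma mult_below: "g \<in> carrier G \<Longrightarrow> x \<in> carrier G \<Longrightarrow> y \<in> carrier G \<Longrightarrow> x \<sqsubset> y \<Longrightarrow> g \<otimes> x \<sqsubset> g \<otimes> y"
  using left_invariant
  unfolding strictly_below_def left_invariant_order_def by auto

lemma mult_below_iff:
  "g \<in> carrier G \<Longrightarrow> x \<in> carrier G \<Longrightarrow> y \<in> carrier G \<Longrightarrow> g \<otimes> x \<sqsubset> g \<otimes> y \<longleftrightarrow> x \<sqsubset> y"
  by (metis below_asym below_total mult_below strictly_below_irrefl)

end

locale numbered_left_ordered_group = left_ordered_group +
  fixes gs :: "nat \<Rightarrow> 'a"
  assumes nontrivial: "carrier G \<noteq> {\<one>}"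
    and numbering: "numbering G gs"
    and gs_0: "gs 0 = \<one>"
begin

text \<open>A nontrivial left-ordered group has positive and negative elements, and multiplying
  \<open>h\<close> by them on the right moves it up and down.\<close>

lemma ex_greater: assumes "h \<in> carrier G" shows "\<exists>k\<in>carrier G. h \<sqsubset> k"
  and ex_less: "\<exists>k\<in>carrier G. k \<sqsubset> h"
proof -
  obtain x where x: "x \<in> carrier G" "x \<noteq> \<one>" using nontrivial by blast
  have lr: "\<one> \<sqsubset> inv x" if "x \<sqsubset> \<one>" using mult_below[of "inv x" x \<one>] that x by simp
  have rl: "inv x \<sqsubset> \<one>" if "\<one> \<sqsubset> x" using mult_below[of "inv x" \<one> x] that x by simp
  consider "\<one> \<sqsubset> x" "inv x \<sqsubset> \<one>" | "\<one> \<sqsubset> inv x" "x \<sqsubset> \<one>" using below_total x lr rl by blast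
  then obtain u v where "u \<in> carrier G" "v \<in> carrier G" "\<one> \<sqsubset> u" "v \<sqsubset> \<one>" using x inv_closed by metis
  then have "h \<sqsubset> h \<otimes> u" "h \<otimes> v \<sqsubset> h" "h \<otimes> u \<in> carrier G" "h \<otimes> v \<in> carrier G"
    using mult_below[of h \<one> u] mult_below[of h v \<one>] assms by auto
  then show "\<exists>k\<in>carrier G. h \<sqsubset> k" "\<exists>k\<in>carrier G. k \<sqsubset> h" by blast+
qed

lemma infinite_carrier: "infinite (carrier G)"
proof
  assume "finite (carrier G)"
  then have "carrier G = {}"
    using finite_transitivity_chain[of "carrier G" "strictly_below r"] below_trans ex_greater
      strictly_below_irrefl by metis
  then show False by auto
qed

lemma numbering_indices: "numbering_indices G = UNIV"
  using infinite_carrier unfolding numbering_indices_def by simp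

lemma bij_gs: "bij_betw gs UNIV (carrier G)"
  using numbering unfolding numbering_def numbering_indices .

lemma gs_closed [simp]: "gs i \<in> carrier G"
  using bij_gs by (auto simp: bij_betw_def)

lemma gs_eq_iff [simp]: "gs i = gs j \<longleftrightarrow> i = j"
  using bij_gs by (auto simp: bij_betw_def inj_def)

lemma ex_gs: assumes "x \<in> carrier G" obtains i where "x = gs i"
  using bij_gs assms by (auto simp: bij_betw_def)

lemma gs_total: "gs i \<sqsubset> gs j \<or> i = j \<or> gs j \<sqsubset> gs i"
  using below_total[of "gs i" "gs j"] by auto

section \<open>Positions of the numbered elements\<close>

abbreviation idx where "idx \<equiv> index_pos r gs"
abbreviation t where "t \<equiv> pos G r gs"

lemma t_gs [simp]: "t (gs i) = idx i"
  unfolding pos_def numbering_indices using bij_gs by (simp add: bij_betw_def)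

lemma idx_Suc_top:
  assumes "\<forall>j\<in>{..i}. gs j \<sqsubset> gs (Suc i)"
  shows "idx (Suc i) = Max (idx ` {..i}) + 1"
  by (subst index_pos.simps(2)) (rule if_P[OF assms])

lemma idx_Suc_bot:
  assumes "\<forall>j\<in>{..i}. gs (Suc i) \<sqsubset> gs j"
  shows "idx (Suc i) = Min (idx ` {..i}) - 1"
proof -
  have "\<not> (\<forall>j\<in>{..i}. gs j \<sqsubset> gs (Suc i))" using assms below_asym by blast
  then show ?thesis
    by (subst index_pos.simps(2), subst if_not_P, assumption) (rule if_P[OF assms])
qed

text \<open>Resolves the definite description in \<open>index_pos\<close>: two adjacent pairs around
  the same element coincide, since otherwise an end of one would lie strictly inside the
  other.\<close>

lemma idx_Suc_midpoint:
  assumes mn: "m \<le> i" "n \<le> i" "gs m \<sqsubset> gs (Suc i)" "gs (Suc i) \<sqsubset> gs n"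
    and adj: "\<And>j. j \<le> i \<Longrightarrow> \<not> (gs m \<sqsubset> gs j \<and> gs j \<sqsubset> gs n)"
  shows "idx (Suc i) = (idx m + idx n) / 2"
proof -
  have no: "\<not> (\<forall>j\<in>{..i}. gs j \<sqsubset> gs (Suc i))" "\<not> (\<forall>j\<in>{..i}. gs (Suc i) \<sqsubset> gs j)"
    using mn below_asym by (meson atMost_iff)+
  have "idx (Suc i) = (THE x. \<exists>m\<in>{..i}. \<exists>n\<in>{..i}.
              gs m \<sqsubset> gs (Suc i) \<and> gs (Suc i) \<sqsubset> gs n \<and>
              (\<forall>j\<in>{..i}. \<not> (gs m \<sqsubset> gs j \<and> gs j \<sqsubset> gs n)) \<and>
              x = (idx m + idx n) / 2)" 
    by (subst index_pos.simps(2), subst if_not_P[OF no(1)]) (rule if_not_P[OF no(2)])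
  also have "\<dots> = (idx m + idx n) / 2"
  proof (rule the_equality)
    show "\<exists>m'\<in>{..i}. \<exists>n'\<in>{..i}. gs m' \<sqsubset> gs (Suc i) \<and> gs (Suc i) \<sqsubset> gs n' \<and>
              (\<forall>j\<in>{..i}. \<not> (gs m' \<sqsubset> gs j \<and> gs j \<sqsubset> gs n')) \<and>
              (idx m + idx n) / 2 = (idx m' + idx n') / 2"
      using assms by (intro bexI[of _ m] bexI[of _ n]) auto
  next
    fix x assume "\<exists>m\<in>{..i}. \<exists>n\<in>{..i}. gs m \<sqsubset> gs (Suc i) \<and> gs (Suc i) \<sqsubset> gs n \<and>
              (\<forall>j\<in>{..i}. \<not> (gs m \<sqsubset> gs j \<and> gs j \<sqsubset> gs n)) \<and>
              x = (idx m + idx n) / 2"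
    then obtain m' n' where *: "m' \<le> i" "n' \<le> i" "gs m' \<sqsubset> gs (Suc i)" "gs (Suc i) \<sqsubset> gs n'"
      and adj': "\<And>j. j \<le> i \<Longrightarrow> \<not> (gs m' \<sqsubset> gs j \<and> gs j \<sqsubset> gs n')" and x: "x = (idx m' + idx n') / 2"
      by auto
    have "m' = m"
      using adj[OF *(1)] adj'[OF mn(1)] gs_total[of m m'] * mn below_trans by blast
    moreover have "n' = n"
      using adj[OF *(2)] adj'[OF mn(2)] gs_total[of n n'] * mn below_trans by blast
    ultimately show "x = (idx m + idx n) / 2" using x by simp
  qed
  finally show ?thesis .
qed

text \<open>Only comparisons with the newly placed element need an argument, one for each clause of
  the recursion.\<close>

lemma idx_strict_mono_upto: "j \<le> i \<Longrightarrow> k \<le> i \<Longrightarrow> gs j \<sqsubset> gs k \<Longrightarrow> idx j < idx k"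
proof (induction i arbitrary: j k)
  case 0
  then show ?case by simp
next
  case (Suc i)
  have le: "idx j \<le> idx k" if "j \<le> i" "k \<le> i" "j = k \<or> gs j \<sqsubset> gs k" for j k
    using Suc.IH that by fastforce
  have "(gs j \<sqsubset> gs (Suc i) \<longrightarrow> idx j < idx (Suc i)) \<and> (gs (Suc i) \<sqsubset> gs j \<longrightarrow> idx (Suc i) < idx j)"
    if j: "j \<le> i" for j
  proof -
    consider (top) "\<forall>j\<in>{..i}. gs j \<sqsubset> gs (Suc i)" | (bot) "\<forall>j\<in>{..i}. gs (Suc i) \<sqsubset> gs j"
      | (mid) "\<exists>j\<in>{..i}. gs j \<sqsubset> gs (Suc i)" "\<exists>j\<in>{..i}. gs (Suc i) \<sqsubset> gs j"
      using gs_total[of _ "Suc i"] by (metis Suc_n_not_le_n atMost_iff)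
    then show ?thesis
    proof cases
      case top
      have "idx j \<le> Max (idx ` {..i})" using j by simp
      moreover have "idx (Suc i) = Max (idx ` {..i}) + 1" using idx_Suc_top top .
      ultimately have "idx j < idx (Suc i)" by linarith
      then show ?thesis using top j below_asym by blast
    next
      case bot
      then have "idx (Suc i) = Min (idx ` {..i}) - 1" by (rule idx_Suc_bot)
      moreover have "Min (idx ` {..i}) \<le> idx j" using j by simp
      ultimately have "idx (Suc i) < idx j" by linarith
      then show ?thesis using bot j below_asym by blast
    next
      case mid
      \<comment> \<open>The neighbours of the new element are chosen by position; the induction
        hypothesis makes them its neighbours in the order as well.\<close>
      let ?A = "{j. j \<le> i \<and> gs j \<sqsubset> gs (Suc i)}" and ?B = "{j. j \<le> i \<and> gs (Suc i) \<sqsubset> gs j}"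
      obtain m where m: "m \<le> i" "gs m \<sqsubset> gs (Suc i)" "\<And>j. j \<in> ?A \<Longrightarrow> idx j \<le> idx m"
        using finite_maximal[of ?A idx] mid by auto
      obtain n where n: "n \<le> i" "gs (Suc i) \<sqsubset> gs n" "\<And>j. j \<in> ?B \<Longrightarrow> idx n \<le> idx j"
        using finite_minimal[of ?B idx] mid by auto
      have "idx (Suc i) = (idx m + idx n) / 2"
      proof (rule idx_Suc_midpoint)
        fix j assume "j \<le> i"
        then show "\<not> (gs m \<sqsubset> gs j \<and> gs j \<sqsubset> gs n)"
          using m n Suc.IH[of m j] Suc.IH[of j n] gs_total[of j "Suc i"] by force
      qed (use m n in auto)
      moreover have "idx m < idx n" using m n below_trans Suc.IH by blast
      ultimately show ?thesis using m(3)[of j] n(3)[of j] j by auto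
    qed
  qed
  then show ?case using Suc by (metis le_Suc_eq strictly_below_irrefl)
qed

lemma idx_less_iff: "idx j < idx k \<longleftrightarrow> gs j \<sqsubset> gs k"
  using idx_strict_mono_upto[of j "max j k" k] idx_strict_mono_upto[of k "max j k" j] gs_total[of j k]
  by (metis less_asym' less_irrefl max.cobounded1 max.cobounded2)

lemma t_less_iff: "x \<in> carrier G \<Longrightarrow> y \<in> carrier G \<Longrightarrow> t x < t y \<longleftrightarrow> x \<sqsubset> y"
  by (metis ex_gs idx_less_iff t_gs)

lemma t_eq_iff: "x \<in> carrier G \<Longrightarrow> y \<in> carrier G \<Longrightarrow> t x = t y \<longleftrightarrow> x = y"
  by (metis below_total less_irrefl t_less_iff)

lemma t_mult_less_iff:
  "g \<in> carrier G \<Longrightarrow> x \<in> carrier G \<Longrightarrow> y \<in> carrier G \<Longrightarrow> t (g \<otimes> x) < t (g \<otimes> y) \<longleftrightarrow> t x < t y"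
  by (simp add: t_less_iff mult_below_iff)

lemma t_one: "t \<one> = 0"
  using t_gs[of 0] by (simp add: gs_0)

section \<open>Unboundedness of the orbit\<close>

lemma ex_t_add_one_le: "\<exists>k. idx i + 1 \<le> idx k"
proof -
  obtain m where m: "m \<le> i" "\<And>j. j \<le> i \<Longrightarrow> idx j \<le> idx m"
    using finite_maximal[of "{..i}" idx] by auto
  \<comment> \<open>The first numbered element above \<open>gs m\<close>, the largest of those up to
    index \<open>i\<close>. It exceeds everything numbered before it and so receives the maximum
    plus one.\<close>
  define k where "k = (LEAST k. gs m \<sqsubset> gs k)"
  have "\<exists>k. gs m \<sqsubset> gs k" using ex_greater[of "gs m"] by (metis ex_gs gs_closed)
  then have mk: "gs m \<sqsubset> gs k" unfolding k_def by (rule LeastI_ex)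
  have least: "\<not> gs m \<sqsubset> gs j" if "j < k" for j using not_less_Least that unfolding k_def by blast
  have "\<not> k \<le> i" using m(2)[of k] mk idx_less_iff[of m k] by auto
  then obtain k' where k': "k = Suc k'" "i \<le> k'" by (cases k) auto
  have "\<forall>j\<in>{..k'}. gs j \<sqsubset> gs k"
    using least mk below_trans gs_total[of _ m] k' by (metis atMost_iff less_Suc_eq_le)
  then have "idx k = Max (idx ` {..k'}) + 1" unfolding k'(1) by (rule idx_Suc_top)
  moreover have "idx i \<le> Max (idx ` {..k'})" using k' by simp
  ultimately show ?thesis by (intro exI[of _ k]) simp
qed

lemma ex_le_t_diff_one: "\<exists>k. idx k \<le> idx i - 1"
proof -
  obtain m where m: "m \<le> i" "\<And>j. j \<le> i \<Longrightarrow> idx m \<le> idx j"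
    using finite_minimal[of "{..i}" idx] by auto
  define k where "k = (LEAST k. gs k \<sqsubset> gs m)"
  have "\<exists>k. gs k \<sqsubset> gs m" using ex_less[of "gs m"] by (metis ex_gs gs_closed)
  then have mk: "gs k \<sqsubset> gs m" unfolding k_def by (rule LeastI_ex)
  have least: "\<not> gs j \<sqsubset> gs m" if "j < k" for j using not_less_Least that unfolding k_def by blast
  have "\<not> k \<le> i" using m(2)[of k] mk idx_less_iff[of k m] by auto
  then obtain k' where k': "k = Suc k'" "i \<le> k'" by (cases k) auto
  have "\<forall>j\<in>{..k'}. gs k \<sqsubset> gs j"
    using least mk below_trans gs_total[of _ m] k' by (metis atMost_iff less_Suc_eq_le)
  then have "idx k = Min (idx ` {..k'}) - 1" unfolding k'(1) by (rule idx_Suc_bot)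
  moreover have "Min (idx ` {..k'}) \<le> idx i" using k' by simp
  ultimately show ?thesis by (intro exI[of _ k]) simp
qed

lemma t_unbounded_above: obtains k where "k \<in> carrier G" "x < t k"
proof -
  have "\<exists>i. real n \<le> idx i" for n
  proof (induction n)
    case 0
    then show ?case by (intro exI[of _ 0]) simp
  next
    case (Suc n)
    then obtain i where "real n \<le> idx i" by blast
    moreover obtain k where "idx i + 1 \<le> idx k" using ex_t_add_one_le by blast
    ultimately show ?case by (intro exI[of _ k]) simp
  qed
  moreover obtain n where "x < real n" using reals_Archimedean2 by blast
  ultimately show thesis using that by (metis gs_closed less_le_trans t_gs)
qed

lemma t_unbounded_below: obtains k where "k \<in> carrier G" "t k < x"
proof -
  have "\<exists>i. idx i \<le> - real n" for n
  proof (induction n)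
    case 0
    then show ?case by (intro exI[of _ 0]) simp
  next
    case (Suc n)
    then obtain i where "idx i \<le> - real n" by blast
    moreover obtain k where "idx k \<le> idx i - 1" using ex_le_t_diff_one by blast
    ultimately show ?case by (intro exI[of _ k]) simp
  qed
  moreover obtain n where "- x < real n" using reals_Archimedean2 by blast
  then have "- real n < x" by simp
  ultimately show thesis using that by (metis gs_closed le_less_trans t_gs)
qed

text \<open>The first element numbered inside the currently smallest interval around the cut is put at its
  midpoint, so the interval around the cut is halved.\<close>

lemma cut_halving:
  assumes cut: "A \<union> B = carrier G" "\<And>x y. x \<in> A \<Longrightarrow> y \<in> B \<Longrightarrow> x \<sqsubset> y"
    and between: "\<And>x y. x \<in> A \<Longrightarrow> y \<in> B \<Longrightarrow> \<exists>k\<in>carrier G. x \<sqsubset> k \<and> k \<sqsubset> y"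
    and ab: "a \<in> A" "b \<in> B"
  obtains a' b' where "a' \<in> A" "b' \<in> B" "t b' - t a' \<le> (t b - t a) / 2"
proof -
  obtain i j where ij: "a = gs i" "b = gs j" using ab cut by (metis UnCI ex_gs)
  define N where "N = max i j"
  let ?A = "{l. l \<le> N \<and> gs l \<in> A}"
  have "i \<in> ?A" using ab ij unfolding N_def by simp
  then have ne: "?A \<noteq> {}" by blast
  have "finite ?A" by simp
  from this ne obtain m where "m \<in> ?A" and m3: "\<And>l. l \<in> ?A \<Longrightarrow> idx l \<le> idx m"
    by (rule finite_maximal[where f = idx]) (rule that)
  then have m: "m \<le> N" "gs m \<in> A" by auto
  let ?B = "{l. l \<le> N \<and> gs l \<in> B}"
  have "j \<in> ?B" using ab ij unfolding N_def by simp
  then have ne: "?B \<noteq> {}" by blast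
  have "finite ?B" by simp
  from this ne obtain n where "n \<in> ?B" and n3: "\<And>l. l \<in> ?B \<Longrightarrow> idx n \<le> idx l"
    by (rule finite_minimal[where f = idx]) (rule that)
  then have n: "n \<le> N" "gs n \<in> B" by auto
  define k where "k = (LEAST k. gs m \<sqsubset> gs k \<and> gs k \<sqsubset> gs n)"
  have "\<exists>k. gs m \<sqsubset> gs k \<and> gs k \<sqsubset> gs n" using between[OF m(2) n(2)] by (metis ex_gs)
  then have k: "gs m \<sqsubset> gs k" "gs k \<sqsubset> gs n" unfolding k_def by (metis (mono_tags, lifting) LeastI)+
  have least: "\<not> (gs m \<sqsubset> gs l \<and> gs l \<sqsubset> gs n)" if "l < k" for l
    using not_less_Least that unfolding k_def by blast
  have kAB: "gs k \<in> A \<or> gs k \<in> B" using cut gs_closed by blast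
  then have "\<not> k \<le> N" using m3[of k] n3[of k] k idx_less_iff[of m k] idx_less_iff[of k n] by auto
  then obtain k' where k': "k = Suc k'" "N \<le> k'" by (cases k) auto
  have "idx k = (idx m + idx n) / 2"
    unfolding k'(1) using k' k m n least by (intro idx_Suc_midpoint) auto
  moreover have "idx i \<le> idx m" "idx n \<le> idx j" using m3[of i] n3[of j] ab ij unfolding N_def by auto
  ultimately have "idx k - idx m \<le> (t b - t a) / 2" "idx n - idx k \<le> (t b - t a) / 2" using ij by (auto simp: field_simps)
  then show thesis using kAB that[of "gs m" "gs k"] that[of "gs k" "gs n"] m n by auto
qed

text \<open>The premise \<open>between\<close> says that no jump sits at the cut, so the halving can
  be iterated.\<close>

lemma cut_small:
  assumes cut: "A \<union> B = carrier G" "\<And>x y. x \<in> A \<Longrightarrow> y \<in> B \<Longrightarrow> x \<sqsubset> y"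
    and between: "\<And>x y. x \<in> A \<Longrightarrow> y \<in> B \<Longrightarrow> \<exists>k\<in>carrier G. x \<sqsubset> k \<and> k \<sqsubset> y"
    and ne: "A \<noteq> {}" "B \<noteq> {}" and e: "0 < e"
  obtains a b where "a \<in> A" "b \<in> B" "t b - t a < e"
proof -
  obtain a b where ab: "a \<in> A" "b \<in> B" using ne by blast
  have "\<exists>a'\<in>A. \<exists>b'\<in>B. t b' - t a' \<le> (t b - t a) * (1/2) ^ n" for n
  proof (induction n)
    case 0
    then show ?case using ab by auto
  next
    case (Suc n)
    then obtain a' b' where *: "a' \<in> A" "b' \<in> B" "t b' - t a' \<le> (t b - t a) * (1/2) ^ n" by blast
    obtain a2 b2 where "a2 \<in> A" "b2 \<in> B" "t b2 - t a2 \<le> (t b' - t a') / 2"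
      using cut_halving[OF cut between *(1,2)] by blast
    then show ?case using * by (intro bexI[of _ a2] bexI[of _ b2]) auto
  qed
  moreover have pos: "0 < t b - t a" using ab cut t_less_iff by (metis UnCI diff_gt_0_iff_gt)
  obtain n where "(1/2) ^ n < e / (t b - t a)"
    using real_arch_pow_inv[of "e / (t b - t a)" "1/2"] e pos by auto
  then have "(t b - t a) * (1/2) ^ n < e" using pos by (simp add: field_simps)
  ultimately show thesis using that by (meson le_less_trans)
qed

end

section \<open>The dynamical realization as an action\<close>

context numbered_left_ordered_group
begin

abbreviation T where "T \<equiv> orbit G r gs"
abbreviation \<rho> where "\<rho> \<equiv> dynamical_realization G r gs"

lemma t_in_orbit [simp]: "k \<in> carrier G \<Longrightarrow> t k \<in> T"
  unfolding orbit_def by simp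

lemma orbit_cases: assumes "x \<in> T" obtains k where "k \<in> carrier G" "x = t k"
  using assms unfolding orbit_def by blast

lemma orbit_action_t: "k \<in> carrier G \<Longrightarrow> orbit_action G r gs g (t k) = t (g \<otimes> k)"
  unfolding orbit_action_def by (simp add: inv_into_f_f inj_on_def t_eq_iff)

lemma closure_action_t: "k \<in> carrier G \<Longrightarrow> closure_action G r gs g (t k) = t (g \<otimes> k)"
  unfolding closure_action_def by (simp add: orbit_action_t)

lemma realization_t: "k \<in> carrier G \<Longrightarrow> \<rho> g (t k) = t (g \<otimes> k)"
  unfolding dynamical_realization_def
  using nontrivial subsetD[OF closure_subset t_in_orbit] by (simp add: closure_action_t)

section \<open>Jumps and limit cuts\<close>

definition jump :: "'a \<Rightarrow> 'a \<Rightarrow> bool" where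
  "jump a b \<longleftrightarrow> a \<in> carrier G \<and> b \<in> carrier G \<and> a \<sqsubset> b \<and> (\<forall>k\<in>carrier G. \<not> (a \<sqsubset> k \<and> k \<sqsubset> b))"

lemma jump_mult:
  assumes "jump a b" "g \<in> carrier G" shows "jump (g \<otimes> a) (g \<otimes> b)"
  unfolding jump_def
proof (intro conjI ballI notI)
  fix k assume k: "k \<in> carrier G" "g \<otimes> a \<sqsubset> k \<and> k \<sqsubset> g \<otimes> b"
  have "g \<otimes> (inv g \<otimes> k) = k" using k assms by (simp flip: m_assoc)
  then have "a \<sqsubset> inv g \<otimes> k \<and> inv g \<otimes> k \<sqsubset> b"
    using k assms unfolding jump_def by (metis inv_closed m_closed mult_below_iff)
  then show False using k assms unfolding jump_def by (meson inv_closed m_closed)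
qed (use assms in \<open>auto simp: jump_def mult_below_iff\<close>)

lemma jump_gap:
  assumes "jump a b" "k \<in> carrier G" shows "t k \<le> t a \<or> t b \<le> t k"
  using assms unfolding jump_def by (metis not_le t_less_iff)

text \<open>At these points the orbit accumulates from both sides, by \<open>limit_cut_small\<close>
  with \<open>g = \<one>\<close>. The intervals over jumps are exactly the complementary intervals
  of the orbit closure.\<close>

definition limit_cut :: "real \<Rightarrow> bool" where
  "limit_cut x \<longleftrightarrow> x \<notin> T \<and> (\<forall>a b. jump a b \<longrightarrow> \<not> (t a < x \<and> x < t b))"

lemma realization_cases:
  obtains (orbit) k where "k \<in> carrier G" "x = t k"
  | (gap) a b where "jump a b" "t a < x" "x < t b"
  | (cut) "limit_cut x"
  unfolding limit_cut_def using orbit_cases by blast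

text \<open>Translating by \<open>g\<close> the cut that \<open>x\<close> makes in the group gives
  another cut without jump, to which \<open>cut_small\<close> applies. This is continuity of the
  orbit action at \<open>x\<close>.\<close>

lemma limit_cut_small:
  assumes x: "limit_cut x" and g: "g \<in> carrier G" and e: "0 < e"
  obtains a b where "a \<in> carrier G" "b \<in> carrier G" "t a < x" "x < t b" "t (g \<otimes> b) - t (g \<otimes> a) < e"
proof -
  define A where "A = (\<lambda>k. g \<otimes> k) ` {k \<in> carrier G. t k < x}"
  define B where "B = (\<lambda>k. g \<otimes> k) ` {k \<in> carrier G. x < t k}"
  obtain a0 where "a0 \<in> carrier G" "t a0 < x" using t_unbounded_below .
  moreover obtain b0 where "b0 \<in> carrier G" "x < t b0" using t_unbounded_above .
  ultimately have ne: "A \<noteq> {}" "B \<noteq> {}" unfolding A_def B_def by blast+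
  have un: "A \<union> B = carrier G"
  proof (intro equalityI subsetI)
    fix k assume k: "k \<in> carrier G"
    then have c: "inv g \<otimes> k \<in> carrier G" "k = g \<otimes> (inv g \<otimes> k)" using g by (simp_all flip: m_assoc)
    then have "t (inv g \<otimes> k) \<noteq> x" using x unfolding limit_cut_def by auto
    then show "k \<in> A \<union> B" using c unfolding A_def B_def by (auto simp: image_iff linorder_neq_iff)
  qed (use g in \<open>auto simp: A_def B_def\<close>)
  have lt: "u \<sqsubset> v" if uv: "u \<in> A" "v \<in> B" for u v
  proof -
    obtain a b where "a \<in> carrier G" "t a < x" "u = g \<otimes> a" "b \<in> carrier G" "x < t b" "v = g \<otimes> b"
      using uv unfolding A_def B_def by blast
    moreover then have "a \<sqsubset> b" using t_less_iff[of a b] by simp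
    ultimately show ?thesis using g mult_below by simp
  qed
  have between: "\<exists>k\<in>carrier G. u \<sqsubset> k \<and> k \<sqsubset> v" if uv: "u \<in> A" "v \<in> B" for u v
  proof -
    obtain a b where ab: "a \<in> carrier G" "t a < x" "u = g \<otimes> a" "b \<in> carrier G" "x < t b" "v = g \<otimes> b"
      using uv unfolding A_def B_def by blast
    moreover have "a \<sqsubset> b" using t_less_iff[of a b] ab by simp
    ultimately obtain k where "k \<in> carrier G" "a \<sqsubset> k" "k \<sqsubset> b"
      using x unfolding limit_cut_def jump_def by blast
    then show ?thesis using ab g mult_below by (intro bexI[of _ "g \<otimes> k"]) auto
  qed
  obtain u v where "u \<in> A" "v \<in> B" and small: "t v - t u < e"
    using un lt between ne e by (rule cut_small)
  then obtain a b where "a \<in> carrier G" "t a < x" "u = g \<otimes> a" "b \<in> carrier G" "x < t b" "v = g \<otimes> b"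
    unfolding A_def B_def by blast
  then show thesis using that small by simp
qed

text \<open>Reduces identities between images of a limit cut to comparisons with translated orbit
  points.\<close>

lemma limit_cut_separated:
  assumes x: "limit_cut x" and g: "g \<in> carrier G"
    and y: "\<And>k. k \<in> carrier G \<Longrightarrow> t k < x \<Longrightarrow> t (g \<otimes> k) \<le> y"
      "\<And>k. k \<in> carrier G \<Longrightarrow> x < t k \<Longrightarrow> y \<le> t (g \<otimes> k)"
    and z: "\<And>k. k \<in> carrier G \<Longrightarrow> t k < x \<Longrightarrow> t (g \<otimes> k) \<le> z"
      "\<And>k. k \<in> carrier G \<Longrightarrow> x < t k \<Longrightarrow> z \<le> t (g \<otimes> k)"
  shows "y = z"
proof (rule ccontr)
  assume "y \<noteq> z"
  then have "0 < \<bar>y - z\<bar>" by simp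
  then obtain a b where "a \<in> carrier G" "b \<in> carrier G" "t a < x" "x < t b" "t (g \<otimes> b) - t (g \<otimes> a) < \<bar>y - z\<bar>"
    using limit_cut_small[OF x g] by blast
  then show False using y(1)[of a] y(2)[of b] z(1)[of a] z(2)[of b] by linarith
qed

lemma limit_cut_in_closure:
  assumes "limit_cut x" shows "x \<in> closure T"
proof -
  have "\<exists>y\<in>T. dist y x < e" if e: "0 < e" for e
  proof -
    obtain a b where "a \<in> carrier G" "b \<in> carrier G" "t a < x" "x < t b" "t (\<one> \<otimes> b) - t (\<one> \<otimes> a) < e"
      using limit_cut_small[OF assms one_closed e] by blast
    then show ?thesis by (intro bexI[of _ "t a"]) (auto simp: dist_real_def)
  qed
  then show ?thesis unfolding closure_approachable by blast
qed

text \<open>The image is the supremum \<open>y\<close> of the translates of orbit points left of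
  \<open>x\<close>; smallness of the translated cut identifies it with the limit in
  \<open>closure_action\<close>.\<close>

lemma realization_limit_cut:
  assumes x: "limit_cut x" and g: "g \<in> carrier G" and k: "k \<in> carrier G"
  shows "t k < x \<Longrightarrow> t (g \<otimes> k) < \<rho> g x" "x < t k \<Longrightarrow> \<rho> g x < t (g \<otimes> k)"
proof -
  define S where "S = (\<lambda>k. t (g \<otimes> k)) ` {k \<in> carrier G. t k < x}"
  define y where "y = Sup S"
  have lt: "t (g \<otimes> a) < t (g \<otimes> b)" if "a \<in> carrier G" "b \<in> carrier G" "t a < x" "x < t b" for a b
    using that g t_mult_less_iff[of g a b] by simp
  obtain b0 where b0: "b0 \<in> carrier G" "x < t b0" using t_unbounded_above by blast
  obtain a0 where a0: "a0 \<in> carrier G" "t a0 < x" using t_unbounded_below by blast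
  have "bdd_above S" unfolding S_def using lt b0 by (intro bdd_aboveI[of _ "t (g \<otimes> b0)"]) (auto intro: less_imp_le)
  then have up: "t (g \<otimes> a) \<le> y" if "a \<in> carrier G" "t a < x" for a
    unfolding y_def by (rule cSup_upper[rotated]) (use that in \<open>auto simp: S_def\<close>)
  have low: "y \<le> t (g \<otimes> b)" if "b \<in> carrier G" "x < t b" for b
    unfolding y_def by (rule cSup_least) (use that a0 lt in \<open>auto simp: S_def intro: less_imp_le\<close>)
  have notT: "x \<notin> T" using x unfolding limit_cut_def by blast
  have up': "t (g \<otimes> a) < y" if a: "a \<in> carrier G" "t a < x" for a
  proof -
    obtain a' b' where "a' \<in> carrier G" "b' \<in> carrier G" "t a' < x" "x < t b'" "t (\<one> \<otimes> b') - t (\<one> \<otimes> a') < x - t a"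
      using limit_cut_small[OF x one_closed, of "x - t a"] a by auto
    then show ?thesis using up[of a'] t_mult_less_iff[of g a a'] a g by simp
  qed
  have low': "y < t (g \<otimes> b)" if b: "b \<in> carrier G" "x < t b" for b
  proof -
    obtain a' b' where "a' \<in> carrier G" "b' \<in> carrier G" "t a' < x" "x < t b'" "t (\<one> \<otimes> b') - t (\<one> \<otimes> a') < t b - x"
      using limit_cut_small[OF x one_closed, of "t b - x"] b by auto
    then show ?thesis using low[of b'] t_mult_less_iff[of g b' b] b g by simp
  qed
  have "(orbit_action G r gs g \<longlongrightarrow> y) (at x within T)"
  proof (rule order_tendstoI)
    fix l assume "l < y"
    then obtain a b where ab: "a \<in> carrier G" "b \<in> carrier G" "t a < x" "x < t b" "t (g \<otimes> b) - t (g \<otimes> a) < y - l"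
      using limit_cut_small[OF x g, of "y - l"] by auto
    then have l: "l < t (g \<otimes> a)" using low[of b] by simp
    show "\<forall>\<^sub>F s in at x within T. l < orbit_action G r gs g s"
      unfolding eventually_at_topological
    proof (intro exI[of _ "{t a<..}"] conjI ballI impI)
      fix s assume s: "s \<in> {t a<..}" "s \<in> T"
      then obtain k where k: "k \<in> carrier G" "s = t k" using orbit_cases by blast
      then show "l < orbit_action G r gs g s"
        using s ab l g t_mult_less_iff[of g a k] by (simp add: orbit_action_t)
    qed (use ab in auto)
  next
    fix l assume "y < l"
    then obtain a b where ab: "a \<in> carrier G" "b \<in> carrier G" "t a < x" "x < t b" "t (g \<otimes> b) - t (g \<otimes> a) < l - y"
      using limit_cut_small[OF x g, of "l - y"] by auto
    then have l: "t (g \<otimes> b) < l" using up[of a] by simp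
    show "\<forall>\<^sub>F s in at x within T. orbit_action G r gs g s < l"
      unfolding eventually_at_topological
    proof (intro exI[of _ "{..<t b}"] conjI ballI impI)
      fix s assume s: "s \<in> {..<t b}" "s \<in> T"
      then obtain k where k: "k \<in> carrier G" "s = t k" using orbit_cases by blast
      then show "orbit_action G r gs g s < l"
        using s ab l g t_mult_less_iff[of g k b] by (simp add: orbit_action_t)
    qed (use ab in auto)
  qed
  \<comment> \<open>\<open>x\<close> is in the closure but not in the orbit, so \<open>Lim\<close>
    is an actual, unique limit.\<close>
  moreover have "at x within T \<noteq> bot"
    using limit_cut_in_closure[OF x] notT by (simp add: trivial_limit_within closure_def)
  ultimately have "Lim (at x within T) (orbit_action G r gs g) = y" by (rule tendsto_Lim[rotated])
  then have "\<rho> g x = y"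
    unfolding dynamical_realization_def closure_action_def
    using limit_cut_in_closure[OF x] notT nontrivial by simp
  then show "t k < x \<Longrightarrow> t (g \<otimes> k) < \<rho> g x" "x < t k \<Longrightarrow> \<rho> g x < t (g \<otimes> k)"
    using up' low' k by auto
qed

lemma realization_gap:
  assumes ab: "jump a b" and x: "t a < x" "x < t b"
  shows "\<rho> g x = t (g \<otimes> a) + (x - t a) / (t b - t a) * (t (g \<otimes> b) - t (g \<otimes> a))"
proof -
  have c: "a \<in> carrier G" "b \<in> carrier G" using ab unfolding jump_def by auto
  \<comment> \<open>An open interval avoiding the orbit avoids its closure, so the supremum and
    infimum in the definition are \<open>t a\<close> and \<open>t b\<close>.\<close>
  have "{t a<..<t b} \<inter> T = {}"
    using jump_gap[OF ab] unfolding orbit_def by force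
  then have empty: "{t a<..<t b} \<inter> closure T = {}"
    by (simp add: open_Int_closure_eq_empty)
  then have out: "s \<le> t a \<or> t b \<le> s" if "s \<in> closure T" for s
    using that by (metis disjoint_iff greaterThanLessThan_iff not_le)
  have "t a \<in> closure T" "t b \<in> closure T" using c closure_subset[of T] by auto
  then have "Sup {s \<in> closure T. s < x} = t a" "Inf {s \<in> closure T. x < s} = t b"
    using x out by (auto intro!: cSup_eq_maximum cInf_eq_minimum) fastforce+
  moreover have "x \<notin> closure T" using empty x by auto
  ultimately show ?thesis
    unfolding dynamical_realization_def Let_def using nontrivial c by (simp add: closure_action_t)
qed

lemma realization_gap_closed:
  assumes ab: "jump a b" and x: "t a \<le> x" "x \<le> t b"
  shows "\<rho> g x = t (g \<otimes> a) + (x - t a) / (t b - t a) * (t (g \<otimes> b) - t (g \<otimes> a))"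
proof -
  have c: "a \<in> carrier G" "b \<in> carrier G" "t a < t b" using ab t_less_iff unfolding jump_def by auto
  show ?thesis
    using realization_gap[OF ab] x c by (cases "x = t a \<or> x = t b") (auto simp: realization_t)
qed

lemma realization_gap_between:
  assumes ab: "jump a b" and x: "t a < x" "x < t b" and g: "g \<in> carrier G"
  shows "t (g \<otimes> a) < \<rho> g x" "\<rho> g x < t (g \<otimes> b)"
proof -
  have c: "a \<in> carrier G" "b \<in> carrier G" "t a < t b" using ab t_less_iff unfolding jump_def by auto
  then have d: "0 < t (g \<otimes> b) - t (g \<otimes> a)" using t_mult_less_iff[of g a b] g by simp
  define s where "s = (x - t a) / (t b - t a)"
  have s: "0 < s" "s < 1" unfolding s_def using x by auto
  have eq: "\<rho> g x = t (g \<otimes> a) + s * (t (g \<otimes> b) - t (g \<otimes> a))" unfolding s_def by (rule realization_gap[OF ab x])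
  show "t (g \<otimes> a) < \<rho> g x" unfolding eq using s d by simp
  have "s * (t (g \<otimes> b) - t (g \<otimes> a)) < 1 * (t (g \<otimes> b) - t (g \<otimes> a))" using s d by (intro mult_strict_right_mono)
  then show "\<rho> g x < t (g \<otimes> b)" unfolding eq by simp
qed

section \<open>Monotonicity and the group law\<close>

lemma realization_order:
  assumes g: "g \<in> carrier G" and k: "k \<in> carrier G"
  shows "t k < x \<Longrightarrow> t (g \<otimes> k) < \<rho> g x" "x < t k \<Longrightarrow> \<rho> g x < t (g \<otimes> k)"
proof -
  have "(t k < x \<longrightarrow> t (g \<otimes> k) < \<rho> g x) \<and> (x < t k \<longrightarrow> \<rho> g x < t (g \<otimes> k))"
  proof (cases x rule: realization_cases)
    case (orbit l)
    then show ?thesis using g k by (simp add: realization_t t_mult_less_iff)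
  next
    case (gap a b)
    have c: "a \<in> carrier G" "b \<in> carrier G" using gap unfolding jump_def by auto
    show ?thesis
      using jump_gap[OF gap(1) k] gap realization_gap_between[OF gap g]
        t_mult_less_iff[OF g k c(1)] t_mult_less_iff[OF g c(1) k] t_mult_less_iff[OF g k c(2)] t_mult_less_iff[OF g c(2) k]
      by linarith
  next
    case cut
    then show ?thesis using realization_limit_cut g k by blast
  qed
  then show "t k < x \<Longrightarrow> t (g \<otimes> k) < \<rho> g x" "x < t k \<Longrightarrow> \<rho> g x < t (g \<otimes> k)" by blast+
qed

text \<open>An orbit point in \<open>[x, y]\<close> separates the images. Otherwise \<open>x\<close>
  is no limit cut, as orbit points would accumulate there from the right, so \<open>x\<close> and
  \<open>y\<close> share a closed gap on which the action is affine with positive slope.\<close>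

lemma realization_strict_mono:
  assumes g: "g \<in> carrier G" and xy: "x < y"
  shows "\<rho> g x < \<rho> g y"
proof (cases "\<exists>k\<in>carrier G. x \<le> t k \<and> t k \<le> y")
  case True
  then obtain k where k: "k \<in> carrier G" "x \<le> t k" "t k \<le> y" by blast
  have "\<rho> g x \<le> t (g \<otimes> k)" "x < t k \<Longrightarrow> \<rho> g x < t (g \<otimes> k)"
    using realization_order(2)[OF g k(1)] realization_t[OF k(1)] k by (auto simp: le_less)
  moreover have "t (g \<otimes> k) \<le> \<rho> g y" "t k < y \<Longrightarrow> t (g \<otimes> k) < \<rho> g y"
    using realization_order(1)[OF g k(1)] realization_t[OF k(1)] k by (auto simp: le_less)
  moreover have "x < t k \<or> t k < y" using xy by linarith
  ultimately show ?thesis by linarith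
next
  case no: False
  show ?thesis
  proof (cases x rule: realization_cases)
    case (orbit k)
    then show ?thesis using no xy by auto
  next
    case cut
    obtain a b where "a \<in> carrier G" "b \<in> carrier G" "t a < x" "x < t b" "t (\<one> \<otimes> b) - t (\<one> \<otimes> a) < y - x"
      using limit_cut_small[OF cut one_closed, of "y - x"] xy by auto
    then have "x \<le> t b \<and> t b \<le> y" by simp
    then show ?thesis using no \<open>b \<in> carrier G\<close> by blast
  next
    case (gap a b)
    have c: "a \<in> carrier G" "b \<in> carrier G" "t a < t b" using gap unfolding jump_def by auto
    have y: "t a \<le> y" "y \<le> t b" using no gap c xy by (auto simp: not_le intro: less_imp_le)
    have "0 < t (g \<otimes> b) - t (g \<otimes> a)" using c g by (simp add: t_mult_less_iff)
    then have "(x - t a) / (t b - t a) * (t (g \<otimes> b) - t (g \<otimes> a)) < (y - t a) / (t b - t a) * (t (g \<otimes> b) - t (g \<otimes> a))"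
      using xy c by (intro mult_strict_right_mono divide_strict_right_mono) auto
    then show ?thesis using realization_gap[OF gap] realization_gap_closed[OF gap(1) y] by simp
  qed
qed

lemma realization_one: "\<rho> \<one> x = x"
proof (cases x rule: realization_cases)
  case (orbit k)
  then show ?thesis by (simp add: realization_t)
next
  case (gap a b)
  then have "a \<in> carrier G" "b \<in> carrier G" unfolding jump_def by auto
  then show ?thesis using realization_gap[OF gap, of \<one>] gap by simp
next
  case cut
  show ?thesis
    by (rule limit_cut_separated[OF cut one_closed])
      (use realization_limit_cut[OF cut one_closed] in \<open>auto intro: less_imp_le\<close>)
qed

lemma realization_mult:
  assumes g: "g \<in> carrier G" and h: "h \<in> carrier G"
  shows "\<rho> (g \<otimes> h) x = \<rho> g (\<rho> h x)"
proof (cases x rule: realization_cases)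
  case (orbit k)
  then show ?thesis using g h by (simp add: realization_t m_assoc)
next
  case (gap a b)
  then have c: "a \<in> carrier G" "b \<in> carrier G" unfolding jump_def by auto
  have "t (h \<otimes> a) < t (h \<otimes> b)" using gap c h by (simp add: t_mult_less_iff)
  then have "(\<rho> h x - t (h \<otimes> a)) / (t (h \<otimes> b) - t (h \<otimes> a)) = (x - t a) / (t b - t a)"
    using realization_gap[OF gap, of h] by simp
  then have "\<rho> g (\<rho> h x) = t (g \<otimes> (h \<otimes> a)) + (x - t a) / (t b - t a) * (t (g \<otimes> (h \<otimes> b)) - t (g \<otimes> (h \<otimes> a)))"
    using realization_gap[OF jump_mult[OF gap(1) h] realization_gap_between[OF gap h], of g] by simp
  then show ?thesis using realization_gap[OF gap, of "g \<otimes> h"] c g h by (simp add: m_assoc)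
next
  \<comment> \<open>Both values are squeezed into the same cut of the orbit translated by
    \<open>g \<otimes> h\<close>.\<close>
  case cut
  have "t (g \<otimes> h \<otimes> k) < \<rho> (g \<otimes> h) x \<and> t (g \<otimes> h \<otimes> k) < \<rho> g (\<rho> h x)"
    if "k \<in> carrier G" "t k < x" for k
    using that g h realization_order(1)[of "g \<otimes> h" k x] realization_order(1)[of h k x]
      realization_order(1)[of g "h \<otimes> k" "\<rho> h x"] by (simp add: m_assoc)
  moreover have "\<rho> (g \<otimes> h) x < t (g \<otimes> h \<otimes> k) \<and> \<rho> g (\<rho> h x) < t (g \<otimes> h \<otimes> k)"
    if "k \<in> carrier G" "x < t k" for k
    using that g h realization_order(2)[of "g \<otimes> h" k x] realization_order(2)[of h k x]
      realization_order(2)[of g "h \<otimes> k" "\<rho> h x"] by (simp add: m_assoc)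
  ultimately show ?thesis
    by (intro limit_cut_separated[OF cut m_closed[OF g h]]) (auto intro: less_imp_le)
qed

text \<open>A fixed interval without orbit points lies in the closure of a single gap, on which the action
  is affine with two fixed points.\<close>

lemma realization_fixes_gap:
  assumes f: "f \<in> carrier G" and fixed: "extend_ereal (\<rho> f) a = a" "extend_ereal (\<rho> f) b = b"
    and x: "a < x" "x < b"
    and empty: "\<And>k. k \<in> carrier G \<Longrightarrow> \<not> (a < ereal (t k) \<and> ereal (t k) < b)"
  shows "extend_ereal (\<rho> f) x = x"
proof -
  obtain x' where x': "x = ereal x'" using x by (cases x) auto
  show ?thesis
  proof (cases x' rule: realization_cases)
    case (orbit k)
    then show ?thesis using empty[of k] x x' by simp
  next
    case cut
    obtain u where u: "a < ereal u" "ereal u < x" using ereal_dense2[OF x(1)] by blast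
    then obtain c d where "c \<in> carrier G" "d \<in> carrier G" "t c < x'" "x' < t d" "t (\<one> \<otimes> d) - t (\<one> \<otimes> c) < x' - u"
      using limit_cut_small[OF cut one_closed, of "x' - u"] x' by auto
    then have "c \<in> carrier G" "u < t c" "t c < x'" by auto
    then have "a < ereal (t c)" "ereal (t c) < b" using u x x' by (meson ereal_less_eq less_ereal.simps(1) less_trans)+
    then show ?thesis using empty \<open>c \<in> carrier G\<close> by blast
  next
    case (gap c d)
    have cd: "c \<in> carrier G" "d \<in> carrier G" "t c < t d" using gap unfolding jump_def by auto
    have "ereal (t c) < b" "a < ereal (t d)" using gap x x' by (metis less_ereal.simps(1) less_trans)+
    \<comment> \<open>Otherwise \<open>t c\<close> or \<open>t d\<close> would be an orbit point
      inside \<open>]a, b[\<close>. In particular \<open>a\<close> and \<open>b\<close> are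
      finite.\<close>
    then have ab: "ereal (t c) \<le> a" "b \<le> ereal (t d)" using empty[of c] empty[of d] cd by auto
    then obtain a' b' where a': "a = ereal a'" and b': "b = ereal b'" using x by (cases a; cases b) auto
    have bounds: "t c \<le> a'" "a' < x'" "x' < b'" "b' \<le> t d" using ab x a' b' x' by auto
    define s where "s = (t (f \<otimes> d) - t (f \<otimes> c)) / (t d - t c)"
    have aff: "\<rho> f z = t (f \<otimes> c) + (z - t c) * s" if "t c \<le> z" "z \<le> t d" for z
      using realization_gap_closed[OF gap(1) that, of f] unfolding s_def by simp
    have fa: "t (f \<otimes> c) + (a' - t c) * s = a'" and fb: "t (f \<otimes> c) + (b' - t c) * s = b'"
      using aff[of a'] aff[of b'] bounds fixed a' b' by (auto simp: extend_ereal_def)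
    then have "(b' - a') * s = (b' - a') * 1" by (simp add: algebra_simps)
    then have "s = 1" using bounds by simp
    then have "\<rho> f x' = x'" using aff[of x'] fa bounds by simp
    then show ?thesis by (simp add: x' extend_ereal_def)
  qed
qed

end

lemma extend_ereal_simps [simp]:
  "extend_ereal f (ereal u) = ereal (f u)" "extend_ereal f \<infinity> = \<infinity>" "extend_ereal f (- \<infinity>) = - \<infinity>"
  by (simp_all add: extend_ereal_def)

section \<open>The realization as an ordered action\<close>

context numbered_left_ordered_group
begin

lemma ordered_line_action: "ordered_line_action G (\<lambda>g. extend_ereal (\<rho> g)) r"
proof unfold_locales
  fix x show "extend_ereal (\<rho> \<one>) x = x" by (cases x) (auto simp: realization_one)
next
  fix g h x assume "g \<in> carrier G" "h \<in> carrier G"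
  then show "extend_ereal (\<rho> (g \<otimes> h)) x = extend_ereal (\<rho> g) (extend_ereal (\<rho> h) x)"
    by (cases x) (auto simp: realization_mult)
next
  fix g x y assume "g \<in> carrier G" "x < (y :: ereal)"
  then show "extend_ereal (\<rho> g) x < extend_ereal (\<rho> g) y"
    by (cases x; cases y) (auto simp: realization_strict_mono)
next
  have orb: "extend_ereal (\<rho> g) 0 = ereal (t g)" if "g \<in> carrier G" for g
    using that realization_t[of \<one> g] by (simp add: t_one zero_ereal_def)
  fix g h assume gh: "g \<in> carrier G" "h \<in> carrier G"
  show "g \<sqsubset> h \<longleftrightarrow> extend_ereal (\<rho> g) 0 < extend_ereal (\<rho> h) 0" using gh by (simp add: orb t_less_iff)
next
  fix g assume g: "g \<in> carrier G" "extend_ereal (\<rho> g) 0 = 0"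
  then have "t g = t \<one>" using realization_t[of \<one> g] by (simp add: t_one zero_ereal_def)
  then show "g = \<one>" using g t_eq_iff by blast
next
  fix f a b x assume "f \<in> carrier G" "extend_ereal (\<rho> f) a = a" "extend_ereal (\<rho> f) b = b" "a < x" "x < b"
    and empty: "\<And>k. k \<in> carrier G \<Longrightarrow> \<not> (a < extend_ereal (\<rho> k) 0 \<and> extend_ereal (\<rho> k) 0 < b)"
  moreover have "extend_ereal (\<rho> k) 0 = ereal (t k)" if "k \<in> carrier G" for k
    using that realization_t[of \<one> k] by (simp add: t_one zero_ereal_def)
  ultimately show "extend_ereal (\<rho> f) x = x" using realization_fixes_gap by metis
qed

end

text \<open>The trivial group is treated apart: its orbit is bounded, and its realization is the
  identity by definition.\<close>

lemma ordered_line_action_realization: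
  fixes G :: "('a, 'm) monoid_scheme" (structure)
  assumes "group G" "left_invariant_order G r" "numbering G gs" "gs 0 = \<one>"
  shows "ordered_line_action G (\<lambda>g. extend_ereal (dynamical_realization G r gs g)) r"
proof -
  interpret group G by fact
  interpret left_ordered_group G r by unfold_locales fact
  show ?thesis
  proof (cases "carrier G = {\<one>}")
    case True
    have id: "extend_ereal (dynamical_realization G r gs g) x = x" for g x
      using True by (cases x) (auto simp: dynamical_realization_def)
    show ?thesis
      by unfold_locales (use True in \<open>auto simp: id\<close>)
  next
    case False
    interpret numbered_left_ordered_group G r gs by unfold_locales fact+
    show ?thesis by (rule ordered_line_action)
  qed
qed

section \<open>Crossed homeomorphisms and abstract crossings\<close>

context line_action
begin

text \<open>\<open>fixes_only_ends\<close> leaves the direction of movement open and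
  \<open>crossed_on\<close> is symmetric in \<open>f\<close> and \<open>g\<close>; passing to the
  inverse and quantifying over both elements absorb these differences.\<close>

lemma crossed_iff_crossing:
  assumes \<phi>: "\<And>g. \<phi> g = extend_ereal (\<psi> g)"
  shows "(\<exists>f\<in>carrier G. \<exists>g\<in>carrier G. crossed_on (\<psi> f) (\<psi> g) a b) \<longleftrightarrow> crossing a b"
proof -
  have ends: "fixes_only_ends (\<psi> f) a b \<longleftrightarrow> expanding f a b \<or> expanding (inv f) a b"
    if f: "f \<in> carrier G" and ab: "a < b" for f
  proof
    assume "fixes_only_ends (\<psi> f) a b"
    then have "x \<in> {a..b} \<and> \<phi> f x = x \<longleftrightarrow> x = a \<or> x = b" for x unfolding fixes_only_ends_def \<phi> by blast
    then show "expanding f a b \<or> expanding (inv f) a b"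
      using ab by (intro expanding_or_expanding_inv[OF f ab]) fastforce+
  next
    assume e: "expanding f a b \<or> expanding (inv f) a b"
    then have "\<phi> f a = a" "\<phi> f b = b" using f unfolding expanding_def by (metis act_inv_eq_iff)+
    moreover have "\<phi> f x \<noteq> x" if "a < x" "x < b" for x
      using e that f unfolding expanding_def by (metis act_inv_eq_iff less_irrefl)
    ultimately show "fixes_only_ends (\<psi> f) a b"
      unfolding fixes_only_ends_def \<phi>[symmetric] using ab by (auto simp: le_less)
  qed
  have inside: "sends_end_inside (\<psi> g) a b \<longleftrightarrow> (a < \<phi> g a \<and> \<phi> g a < b) \<or> (a < \<phi> g b \<and> \<phi> g b < b)" for g
    unfolding sends_end_inside_def \<phi>[symmetric] by auto
  show ?thesis
  proof
    assume "\<exists>f\<in>carrier G. \<exists>g\<in>carrier G. crossed_on (\<psi> f) (\<psi> g) a b"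
    then show "crossing a b"
      unfolding crossed_on_def crossing_def left_crossing_def right_crossing_def using ends inside by metis
  next
    assume c: "crossing a b"
    then obtain f g where "expanding f a b" "g \<in> carrier G" "sends_end_inside (\<psi> g) a b"
      unfolding crossing_def left_crossing_def right_crossing_def inside by blast
    then show "\<exists>f\<in>carrier G. \<exists>g\<in>carrier G. crossed_on (\<psi> f) (\<psi> g) a b"
      unfolding crossed_on_def using ends crossing_less[OF c] expanding_def by metis
  qed
qed

end

theorem proposition3p30:
  fixes G :: "('a, 'm) monoid_scheme" (structure)
    and r :: "('a \<times> 'a) set"
    and gs :: "nat \<Rightarrow> 'a"
  assumes "group G"
    and "countable (carrier G)"
    and "left_invariant_order G r"
    and "numbering G gs"
    and "gs 0 = \<one>"
  shows "conradian_soul G r =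
         interval_stabilizer G r gs (crossing_alpha G r gs) (crossing_beta G r gs)"
proof -
  let ?\<phi> = "\<lambda>g. extend_ereal (dynamical_realization G r gs g)"
  interpret ordered_line_action G ?\<phi> r
    using assms by (intro ordered_line_action_realization)
  have crossed: "(\<exists>f\<in>carrier G. \<exists>g\<in>carrier G.
      crossed_on (dynamical_realization G r gs f) (dynamical_realization G r gs g) a b) \<longleftrightarrow> crossing a b" for a b
    by (rule crossed_iff_crossing) simp
  \<comment> \<open>The inequality between the ends, a bounded quantifier in these definitions, is
    already contained in \<open>crossed_on\<close>.\<close>
  have "crossing_alpha G r gs = alpha" "crossing_beta G r gs = beta"
    unfolding crossing_alpha_def crossing_beta_def alpha_def beta_def crossed[symmetric]
    by (rule arg_cong[where f = Sup] arg_cong[where f = Inf]; force simp: crossed_on_def)+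
  then show ?thesis
    unfolding conradian_soul_eq end_stabilizer_def interval_stabilizer_def by simp
qed

end
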